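(* Let $F$ be an arbitrary field. Let $f:\mathbb{N}\rightarrow\mathbb{N}$ be a monotone, submultiplicative function such that there exists some $C>0$ for which $f(Cn)\geq n f(n)$ for all $n\in\mathbb{N}$. Then there exists a finitely generated, prime monomial $F$-algebra which contains a non-zero locally nilpotent ideal and has growth type equivalent to $f$.
   Context: $\mathbb{N}=\{1,2,3,\dots\}$. Monotone means monotone increasing, i.e. $f(n)\le f(n+1)$ for all $n$. A function $f:\mathbb{N}\to\mathbb{N}$ is submultiplicative if $f(m+n)\leq f(m)f(n)$ for all $m,n\in\mathbb{N}$. Constants such as $C$ (and $C,D$ below) may be taken to be positive integers, so that the expressions $f(Cn)$ make sense. A finitely generated monomial algebra over $F$ is a quotient $F\langle x_1,\dots,x_d\rangle/I$ of a free associative unital algebra on finitely many generators by an ideal $I$ generated by monomials (words in the $x_i$). For a finitely generated $F$-algebra $B$ with a finite-dimensional generating subspace $V$, the growth function is $n\mapsto \dim_F B(n)$, where $B(n)=F+V+V^2+\cdots+V^n$. Growth functions are considered up to the equivalence: $f\sim g$ if and only if there exist $C,D>0$ with $f(n)\leq g(Cn)\leq f(Dn)$ for all $n\in\mathbb{N}$. "Growth type equivalent to $f$" means that the growth function of the algebra is $\sim f$ (this does not depend on $V$). A (two-sided) ideal is locally nilpotent if every finite subset $S$ of it satisfies $S^n=0$ for some $n$, where $S^n$ is the set of products of $n$ elements of $S$. *)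

theory Defs
  imports
    "HOL-Algebra.QuotRing"
    "HOL-Algebra.Ideal_Product"
    "HOL-Algebra.Subrings"
    "Jordan_Normal_Form.Missing_VectorSpace"
begin

section \<open>Associative algebras over a field\<close>

text \<open>
  An (associative, unital, not necessarily commutative) algebra over \<open>F\<close> is represented by a
  record of type \<^type>\<open>module\<close>, which has both a ring multiplication and a scalar multiplication.
  The locale \<open>algebra\<close> of the library is not used because it requires a commutative ring.
\<close>

subsection \<open>The free algebra\<close>

text \<open>
  The free algebra on \<open>x\<^sub>0, \<dots>, x\<^sub>d\<^sub>-\<^sub>1\<close>. A word is a list over \<open>{..<d}\<close>, and an element is the
  finitely supported function that sends a word to its coefficient. The product is the convolution
  over all factorisations \<open>w = take i w @ drop i w\<close>.
\<close>

definition free_algebra :: "('a, 'b) ring_scheme \<Rightarrow> nat \<Rightarrow> ('a, nat list \<Rightarrow> 'a) module" where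
  "free_algebra F d =
    \<lparr> carrier = {p \<in> UNIV \<rightarrow> carrier F.
                  finite {w. p w \<noteq> \<zero>\<^bsub>F\<^esub>} \<and> {w. p w \<noteq> \<zero>\<^bsub>F\<^esub>} \<subseteq> lists {..<d}},
      mult = (\<lambda>p q w. \<Oplus>\<^bsub>F\<^esub> i \<in> {..length w}. p (take i w) \<otimes>\<^bsub>F\<^esub> q (drop i w)),
      one = (\<lambda>w. if w = [] then \<one>\<^bsub>F\<^esub> else \<zero>\<^bsub>F\<^esub>),
      zero = (\<lambda>w. \<zero>\<^bsub>F\<^esub>),
      add = (\<lambda>p q w. p w \<oplus>\<^bsub>F\<^esub> q w),
      smult = (\<lambda>c p w. c \<otimes>\<^bsub>F\<^esub> p w) \<rparr>"

definition monomial :: "('a, 'b) ring_scheme \<Rightarrow> nat list \<Rightarrow> nat list \<Rightarrow> 'a" where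
  "monomial F u = (\<lambda>w. if w = u then \<one>\<^bsub>F\<^esub> else \<zero>\<^bsub>F\<^esub>)"

subsection \<open>Quotients\<close>

text \<open>The quotient ring \<open>A Quot I\<close> with \<open>c \<odot> (I + a) = I + c \<odot> a\<close>.\<close>

definition quotient_algebra ::
  "('a, 'c) module \<Rightarrow> 'c set \<Rightarrow> ('a, 'c set) module" where
  "quotient_algebra A I =
    \<lparr> carrier = carrier (A Quot I),
      mult = mult (A Quot I),
      one = one (A Quot I),
      zero = zero (A Quot I),
      add = add (A Quot I),
      smult = (\<lambda>c X. \<Union>x\<in>X. I +>\<^bsub>A\<^esub> (c \<odot>\<^bsub>A\<^esub> x)) \<rparr>"

definition fg_monomial_algebra ::
  "('a, 'b) ring_scheme \<Rightarrow> ('a, (nat list \<Rightarrow> 'a) set) module \<Rightarrow> bool" where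
  "fg_monomial_algebra F B \<longleftrightarrow>
    (\<exists>d W. W \<subseteq> lists {..<d} \<and>
      B = quotient_algebra (free_algebra F d) (Idl\<^bsub>free_algebra F d\<^esub> (monomial F ` W)))"

section \<open>Prime rings and locally nilpotent ideals\<close>

definition prime_ring :: "('a, 'b) ring_scheme \<Rightarrow> bool" where
  "prime_ring R \<longleftrightarrow> ring R \<and> carrier R \<noteq> {\<zero>\<^bsub>R\<^esub>} \<and>
    (\<forall>I J. ideal I R \<and> ideal J R \<and> I \<cdot>\<^bsub>R\<^esub> J = {\<zero>\<^bsub>R\<^esub>} \<longrightarrow> I = {\<zero>\<^bsub>R\<^esub>} \<or> J = {\<zero>\<^bsub>R\<^esub>})"

text \<open>The set of all products \<open>s\<^sub>1 \<cdots> s\<^sub>n\<close> with all \<open>s\<^sub>i\<close> in \<open>S\<close>; it is \<open>{\<one>}\<close> for \<open>n = 0\<close>.\<close>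

definition n_fold_products :: "('a, 'b) ring_scheme \<Rightarrow> 'a set \<Rightarrow> nat \<Rightarrow> 'a set" where
  "n_fold_products R S n =
    {foldr (mult R) xs \<one>\<^bsub>R\<^esub> | xs. set xs \<subseteq> S \<and> length xs = n}"

text \<open>The inclusion, rather than an equation, accounts for \<open>S = {}\<close>.\<close>

definition locally_nilpotent :: "('a, 'b) ring_scheme \<Rightarrow> 'a set \<Rightarrow> bool" where
  "locally_nilpotent R J \<longleftrightarrow>
    (\<forall>S. finite S \<and> S \<subseteq> J \<longrightarrow> (\<exists>n\<ge>1. n_fold_products R S n \<subseteq> {\<zero>\<^bsub>R\<^esub>}))"

section \<open>Growth\<close>

definition fd_generating_subspace ::
  "('a, 'b) ring_scheme \<Rightarrow> ('a, 'c) module \<Rightarrow> 'c set \<Rightarrow> bool" where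
  "fd_generating_subspace F B V \<longleftrightarrow>
    VectorSpace.subspace F V B \<and> vectorspace.fin_dim F (B\<lparr>carrier := V\<rparr>) \<and>
    (\<forall>A. subring A B \<and> VectorSpace.subspace F A B \<and> V \<subseteq> A \<longrightarrow> A = carrier B)"

text \<open>
  \<open>B(n) = F + V + V\<^sup>2 + \<dots> + V\<^sup>n\<close>: since \<open>V\<^sup>k\<close> is the span of the \<open>k\<close>-fold products of elements of
  \<open>V\<close> (and \<open>V\<^sup>0 = F\<close>), the sum is the span of all the \<open>k\<close>-fold products with \<open>k \<le> n\<close>.
\<close>

definition growth_space ::
  "('a, 'b) ring_scheme \<Rightarrow> ('a, 'c) module \<Rightarrow> 'c set \<Rightarrow> nat \<Rightarrow> 'c set" where
  "growth_space F B V n = LinearCombinations.module.span F B (\<Union>k\<le>n. n_fold_products B V k)"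

definition growth_function ::
  "('a, 'b) ring_scheme \<Rightarrow> ('a, 'c) module \<Rightarrow> 'c set \<Rightarrow> nat \<Rightarrow> nat" where
  "growth_function F B V n = vectorspace.dim F (B\<lparr>carrier := growth_space F B V n\<rparr>)"

text \<open>Functions on the positive integers are represented on \<^typ>\<open>nat\<close>; the value at 0 is ignored.\<close>

definition growth_equiv :: "(nat \<Rightarrow> nat) \<Rightarrow> (nat \<Rightarrow> nat) \<Rightarrow> bool" where
  "growth_equiv f g \<longleftrightarrow>
    (\<exists>C\<ge>1. \<exists>D\<ge>1. \<forall>n\<ge>1. f n \<le> g (C * n) \<and> g (C * n) \<le> f (D * n))"

text \<open>
  The growth type does not depend on the generating subspace, so all of them are required to give
  \<open>f\<close>; the first conjunct (\<open>B\<close> is finitely generated) keeps this from being vacuous.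
\<close>

definition has_growth_type ::
  "('a, 'b) ring_scheme \<Rightarrow> ('a, 'c) module \<Rightarrow> (nat \<Rightarrow> nat) \<Rightarrow> bool" where
  "has_growth_type F B f \<longleftrightarrow>
    (\<exists>V. fd_generating_subspace F B V) \<and>
    (\<forall>V. fd_generating_subspace F B V \<longrightarrow> growth_equiv (growth_function F B V) f)"

end

theory Submission
  imports Defs "HOL-Library.Sublist" "HOL-Library.Countable"
begin

text \<open>
  A monomial algebra is given by the factor-closed language \<open>L\<close> of its non-zero words, and its growth
  counts words. Let \<open>L\<close> be the set of factors of words in \<open>W 0, W 1, \<dots>\<close>, where \<open>W 0\<close> consists of the
  letters and \<open>W (k + 1) = C k W k\<close> with \<open>C k \<subseteq> W k\<close> of size about \<open>f (2\<^sup>k\<^sup>+\<^sup>1) / f (2\<^sup>k)\<close>, so that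
  \<open>card (W k)\<close> equals \<open>f (2\<^sup>k)\<close> up to a factor polynomial in \<open>2\<^sup>k\<close>. A word of length at most \<open>2\<^sup>k\<close> is a
  factor of a word in \<open>C k W k\<close> or \<open>W k C k\<close>; hence the growth is at most a polynomial times \<open>f (4 n)\<close>,
  and the hypothesis \<open>n f (n) \<le> f (C n)\<close> absorbs the polynomial.

  Every word of \<open>W j\<close> is, for some later \<open>k\<close>, a suffix of a word put into \<open>C k\<close>, so any two words \<open>u\<close>, \<open>v\<close>
  occur in some \<open>u w v \<in> L\<close>; comparing monomials of maximal length shows that the algebra is prime. For
  infinitely many \<open>k\<close> no word of \<open>C k\<close> contains the letter \<open>0\<close>; then the occurrences of \<open>0\<close> cannot cross
  blocks of length \<open>2\<^sup>k\<close> by steps of bounded size, so the ideal spanned by the words containing \<open>0\<close> is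
  locally nilpotent.
\<close>

section \<open>Languages built from blocks\<close>

text \<open>How \<open>C k\<close> is chosen stays open here: primeness and sparsity of the letter
  \<open>0\<close> get their own assumptions on these heads, and the word count holds for every
  choice.\<close>

locale block_language =
  fixes d :: nat and W C :: "nat \<Rightarrow> nat list set"
  assumes W_0: "W 0 = (\<lambda>a. [a]) ` {..<d}"
    and W_Suc: "W (Suc k) = {c @ w | c w. c \<in> C k \<and> w \<in> W k}"
    and C_subset: "C k \<subseteq> W k"
    and C_nonempty: "C k \<noteq> {}"
begin

definition lang :: "nat list set" where
  "lang = {s. \<exists>m. \<exists>w \<in> W m. sublist s w}"

lemma length_W: "w \<in> W k \<Longrightarrow> length w = 2 ^ k"
  using C_subset by (induction k arbitrary: w) (fastforce simp: W_0 W_Suc)+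

lemma W_nonempty: "W k \<noteq> {}"
  using C_subset C_nonempty by blast

lemma W_alphabet: "W k \<subseteq> lists {..<d}"
  using C_subset by (induction k) (fastforce simp: W_0 W_Suc)+

lemma finite_W: "finite (W k)"
proof (rule finite_subset)
  show "W k \<subseteq> {w. set w \<subseteq> {..<d} \<and> length w = 2 ^ k}"
    using W_alphabet length_W by blast
qed (simp add: finite_lists_length_eq)

lemma finite_C: "finite (C k)"
  using finite_subset[OF C_subset finite_W] .

lemma lang_alphabet: "lang \<subseteq> lists {..<d}"
  unfolding lang_def using W_alphabet set_mono_sublist by fastforce

lemma lang_sublist: "s \<in> lang \<Longrightarrow> sublist t s \<Longrightarrow> t \<in> lang"
  unfolding lang_def using sublist_order.order_trans by blast

lemma W_subset_lang: "W k \<subseteq> lang"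
  unfolding lang_def by blast

text \<open>Since \<open>C m\<close> is non-empty, every block is the second half of some longer
  block, so suffixes (unlike prefixes) survive at all higher levels.\<close>

lemma suffix_W_mono:
  assumes "u \<in> W k" "k \<le> m"
  shows "\<exists>w \<in> W m. suffix u w"
  using assms(2)
proof (induction m rule: dec_induct)
  case base
  then show ?case using assms(1) by blast
next
  case (step m)
  then obtain w where "w \<in> W m" "suffix u w" by blast
  moreover obtain c where "c \<in> C m" using C_nonempty by blast
  ultimately have "c @ w \<in> W (Suc m)" "suffix u (c @ w)"
    by (auto simp: W_Suc suffix_def)
  then show ?case by blast
qed

lemma suffix_in_W:
  assumes "w \<in> W m" "k \<le> m"
  shows "\<exists>b \<in> W k. suffix b w"
  using assms(2,1)
proof (induction m arbitrary: w rule: dec_induct)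
  case base
  then show ?case by blast
next
  case (step m)
  then obtain c v where "w = c @ v" "v \<in> W m" by (auto simp: W_Suc)
  with step.IH show ?case by (meson suffix_appendI)
qed

text \<open>Passing to first halves stays among the blocks because \<open>C m\<close> lies in
  \<open>W m\<close>, and the last passage, from level \<open>Suc k\<close>, lands in
  \<open>C k\<close>.\<close>

lemma prefix_in_C:
  assumes "w \<in> W m" "Suc k \<le> m"
  shows "\<exists>a \<in> C k. prefix a w"
  using assms(2,1)
proof (induction m arbitrary: w rule: dec_induct)
  case base
  then obtain c v where "w = c @ v" "c \<in> C k" by (auto simp: W_Suc)
  then show ?case by (auto intro!: bexI[of _ c])
next
  case (step m)
  then obtain c v where "w = c @ v" "c \<in> W m"
    using C_subset by (fastforce simp: W_Suc)
  with step.IH show ?case by (meson prefix_prefix)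
qed

text \<open>Both words are lifted to suffixes of blocks of a common level \<open>K\<close> that
  serves the target \<open>u'\<close>; a head ending in \<open>u'\<close> followed by a block ending
  in \<open>v'\<close> is then a block. The assumption is an implication because a target can only
  be served if some block ends in it, which the lifting of \<open>u'\<close> provides.\<close>

lemma lang_prime:
  assumes target: "\<And>u k. \<exists>K\<ge>k. (\<exists>w \<in> W K. suffix u w) \<longrightarrow> (\<exists>c \<in> C K. suffix u c)"
    and "u \<in> lang" "v \<in> lang"
  shows "\<exists>w. u @ w @ v \<in> lang"
proof -
  obtain i u' where u': "u' \<in> W i" "sublist u u'" using assms by (auto simp: lang_def)
  obtain j v' where v': "v' \<in> W j" "sublist v v'" using assms by (auto simp: lang_def)
  obtain K where K: "K \<ge> max i j"
    "(\<exists>w \<in> W K. suffix u' w) \<longrightarrow> (\<exists>c \<in> C K. suffix u' c)" using target by blast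
  obtain c where c: "c \<in> C K" "suffix u' c"
    using K suffix_W_mono[OF u'(1), of K] by auto
  obtain w where w: "w \<in> W K" "suffix v' w"
    using K suffix_W_mono[OF v'(1), of K] by auto
  have "c @ w \<in> lang" using c w W_subset_lang[of "Suc K"] by (auto simp: W_Suc)
  moreover obtain p q where "c = p @ u @ q"
    using c(2) u'(2) by (auto simp: suffix_def sublist_def) (metis append.assoc)
  moreover obtain r s where "w = r @ v @ s"
    using w(2) v'(2) by (auto simp: suffix_def sublist_def) (metis append.assoc)
  ultimately have "p @ (u @ (q @ r) @ v) @ s \<in> lang" by simp
  then show ?thesis using lang_sublist sublist_appendI by blast
qed

section \<open>Positions of the letter \<open>0\<close>\<close>

text \<open>In a word of \<open>W m\<close>, an even-numbered block of length \<open>2 ^ k\<close> is the first half of a block of length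
  \<open>2 ^ Suc k\<close>, so it belongs to \<open>C k\<close>.\<close>

lemma zeros_in_odd_blocks:
  assumes "\<forall>c \<in> C k. 0 \<notin> set c" "Suc k \<le> m" "w \<in> W m" "p < length w" "w ! p = 0"
  shows "odd (p div 2 ^ k)"
  using assms(2-)
proof (induction m arbitrary: w p rule: dec_induct)
  case base
  then obtain c v where w: "w = c @ v" "c \<in> C k" "v \<in> W k" by (auto simp: W_Suc)
  have len: "length c = 2 ^ k" "length v = 2 ^ k"
    using w length_W C_subset by blast+
  have "\<not> p < 2 ^ k"
    using w base len assms(1) by (metis nth_append nth_mem)
  moreover have "p < 2 * 2 ^ k" using base len w by simp
  ultimately have "p div 2 ^ k = 1" by (simp add: div_nat_eqI)
  then show ?case by simp
next
  case (step m)
  then obtain c v where w: "w = c @ v" "c \<in> C m" "v \<in> W m" by (auto simp: W_Suc)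
  have c: "c \<in> W m" using w C_subset by blast
  have len: "length c = 2 ^ m" "length v = 2 ^ m"
    using w c length_W by blast+
  show ?case
  proof (cases "p < length c")
    case True
    then show ?thesis using step.IH[OF c] step.prems w by (simp add: nth_append)
  next
    case False
    have "odd ((p - length c) div 2 ^ k)"
      using step.IH[OF w(3), of "p - length c"] step.prems w False by (simp add: nth_append)
    \<comment> \<open>The first half spans an even number of blocks of length \<open>2 ^ k\<close>,
      so numbering from the start of the second half preserves parity.\<close>
    moreover have "length c = 2 ^ (m - k) * 2 ^ k"
      using step.hyps len by (simp flip: power_add)
    then have "p div 2 ^ k = (p - length c) div 2 ^ k + 2 ^ (m - k)"
      using False by (metis div_add1_eq le_add_diff_inverse2 linorder_not_less mod_mult_self2_is_0
          add.commute div_mult_self1 power_not_zero zero_neq_numeral)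
    moreover have "even ((2::nat) ^ (m - k))" using step.hyps by simp
    ultimately show ?thesis by simp
  qed
qed

end

text \<open>Zeros at distance at most \<open>M\<close>, both in odd-numbered blocks of length \<open>M\<close>, share a block.\<close>

lemma zeros_advance:
  fixes M :: nat
  assumes odd: "\<And>p. p < length w \<Longrightarrow> w ! p = (0::nat) \<Longrightarrow> odd (p div M)"
    and "2 * N \<le> M" and "0 < M"
    and xs: "\<And>y. y \<in> set (x # xs) \<Longrightarrow> 0 \<in> set y \<and> length y \<le> N"
    and "w = a @ concat (x # xs) @ b"
    and "length a \<le> p" "p < length a + length x" "w ! p = 0"
  shows "\<exists>q\<ge>p + length xs. q div M = p div M"
  using xs assms(5-)
proof (induction xs arbitrary: x a p)
  case Nil
  then show ?case by auto
next
  case (Cons y ys)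
  obtain i where i: "i < length y" "y ! i = 0"
    using Cons.prems(1)[of y] by (auto simp: in_set_conv_nth)
  define q where "q = length a + length x + i"
  have wq: "w ! q = 0" "q < length w" "p < length w"
    using i Cons.prems(2-) by (auto simp: q_def nth_append)
  have "\<exists>r\<ge>q + length ys. r div M = q div M"
    by (rule Cons.IH[of y "a @ x"]) (use Cons.prems i wq in \<open>auto simp: q_def\<close>)
  moreover have "q div M = p div M"
  proof -
    \<comment> \<open>Zeros in adjacent factors of length at most \<open>N\<close> are less than
      \<open>2 * N\<close> apart, so the block number grows by at most 1; growth by exactly 1 would
      change its parity.\<close>
    have "length x \<le> N" "length y \<le> N" using Cons.prems(1) by auto
    then have "q \<le> p + M" using Cons.prems(3) i(1) assms(2) by (simp add: q_def)
    then have "q div M \<le> Suc (p div M)" using \<open>0 < M\<close>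
      by (metis div_add_self2 div_le_mono not_gr_zero Suc_eq_plus1)
    moreover have "p div M \<le> q div M"
      using Cons.prems(4) by (intro div_le_mono) (simp add: q_def)
    moreover have "odd (p div M)" "odd (q div M)" using odd wq Cons.prems(5) by auto
    ultimately show ?thesis by (metis even_Suc le_SucE order_antisym)
  qed
  moreover have "p < q" using Cons.prems(4) by (simp add: q_def)
  ultimately show ?case by (metis add_Suc_right Suc_leI add_le_mono1 length_Cons add_Suc order_trans)
qed

context block_language
begin

text \<open>If short factors all contain \<open>0\<close>, consecutive zeros never leave one block
  of length \<open>2 ^ k\<close>, yet each factor moves at least one position to the right.\<close>

lemma lang_zeros_sparse:
  assumes free: "\<And>i. \<exists>k\<ge>i. \<forall>c \<in> C k. 0 \<notin> set c"
  shows "\<exists>n\<ge>1. \<forall>xs. length xs = n \<longrightarrow> (\<forall>x \<in> set xs. 0 \<in> set x \<and> length x \<le> N) \<longrightarrow> concat xs \<notin> lang"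
proof -
  obtain k where k: "k \<ge> 2 * N" "\<forall>c \<in> C k. 0 \<notin> set c" using free by blast
  have M: "2 * N \<le> 2 ^ k" using k(1) less_exp[of k] by linarith
  \<comment> \<open>One factor supplies the initial zero; the remaining \<open>2 ^ k\<close> factors
    would push it by the full length of its block.\<close>
  have "concat xs \<notin> lang"
    if xs: "length xs = Suc (2 ^ k)" "\<forall>x \<in> set xs. 0 \<in> set x \<and> length x \<le> N" for xs
  proof
    assume "concat xs \<in> lang"
    then obtain m w0 where m: "w0 \<in> W m" "sublist (concat xs) w0" by (auto simp: lang_def)
    \<comment> \<open>The parity statement needs level at least \<open>Suc k\<close>, so the
      surrounding block is enlarged if necessary.\<close>
    then obtain w where w: "w \<in> W (max m (Suc k))" "suffix w0 w"
      using suffix_W_mono by (meson max.cobounded1)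
    obtain a b where w_eq: "w = a @ concat xs @ b"
      using w(2) m(2) by (auto simp: suffix_def sublist_def) (metis append.assoc)
    obtain y ys where ys: "xs = y # ys" "length ys = 2 ^ k" using xs(1) by (cases xs) auto
    obtain i where i: "i < length y" "y ! i = 0" using xs(2) ys(1) by (auto simp: in_set_conv_nth)
    have "\<exists>q\<ge>(length a + i) + length ys. q div 2 ^ k = (length a + i) div 2 ^ k"
    proof (rule zeros_advance[where N = N and w = w and a = a and b = b and x = y])
      show "odd (p div 2 ^ k)" if "p < length w" "w ! p = 0" for p
        using zeros_in_odd_blocks[OF k(2) _ w(1) that] by simp
    qed (use M xs ys i w_eq in \<open>auto simp: nth_append\<close>)
    then obtain q where "q \<ge> length a + i + 2 ^ k" "q div 2 ^ k = (length a + i) div 2 ^ k"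
      using ys(2) by auto
    then have "(length a + i + 2 ^ k) div 2 ^ k \<le> (length a + i) div 2 ^ k"
      by (metis div_le_mono)
    then show False by simp
  qed
  then show ?thesis by (intro exI[of _ "Suc (2 ^ k)"]) auto
qed

text \<open>Descend into halves as long as the word lies in one of them. If it straddles a midpoint,
  it lies in the last \<open>2 ^ k\<close> letters of the first half, a block of \<open>W k\<close>,
  followed by the first \<open>2 ^ k\<close> letters of the second half, a block of
  \<open>C k\<close>. If the descent reaches level \<open>Suc k\<close>, the order of the two types
  is reversed. One of the two blocks is thus always a head, which keeps the count small.\<close>

lemma short_word_in_two_blocks:
  assumes "sublist s w" "w \<in> W m" "Suc k \<le> m" "length s \<le> 2 ^ k"
  shows "\<exists>a b. sublist s (a @ b) \<and> (a, b) \<in> C k \<times> W k \<union> W k \<times> C k"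
  using assms(3,1,2)
proof (induction m arbitrary: w rule: dec_induct)
  case base
  then show ?case by (auto simp: W_Suc)
next
  case (step m)
  then obtain c v where w: "w = c @ v" "c \<in> W m" "v \<in> W m"
    using C_subset by (fastforce simp: W_Suc)
  consider "sublist s c" | "sublist s v"
    | s1 s2 where "s = s1 @ s2" "suffix s1 c" "prefix s2 v"
    using step.prems w(1) by (auto simp: sublist_append)
  then show ?case
  proof cases
    case 3
    obtain a where a: "a \<in> W k" "suffix a c" using suffix_in_W[OF w(2), of k] step.hyps by auto
    obtain b where b: "b \<in> C k" "prefix b v" using prefix_in_C[OF w(3)] step.hyps by auto
    have "length a = 2 ^ k" "length b = 2 ^ k" using a b length_W C_subset by blast+
    then have "suffix s1 a" "prefix s2 b"
      using 3 a b assms(4) by (auto intro: suffix_length_suffix prefix_length_prefix)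
    then have "sublist s (a @ b)" using 3(1) by (auto simp: sublist_append)
    then show ?thesis using a b by blast
  qed (use step.IH w in blast)+
qed

text \<open>A factor of \<open>a @ b\<close> is determined by its starting position and its length,
  both at most \<open>2 ^ Suc k\<close>. These choices cost a quadratic factor in
  \<open>card_short_words\<close>.\<close>

lemma short_words_subset:
  "{s \<in> lang. length s \<le> 2 ^ k} \<subseteq>
    (\<Union>(a, b) \<in> C k \<times> W k \<union> W k \<times> C k. (\<lambda>(i, j). take j (drop i (a @ b))) ` ({..2 ^ Suc k} \<times> {..2 ^ Suc k}))"
proof
  fix s assume "s \<in> {s \<in> lang. length s \<le> 2 ^ k}"
  then obtain m w0 where m: "w0 \<in> W m" "sublist s w0" "length s \<le> 2 ^ k" by (auto simp: lang_def)
  then obtain w where w: "w \<in> W (max m (Suc k))" "suffix w0 w"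
    using suffix_W_mono by (meson max.cobounded1)
  have "sublist s w" using m w by (meson sublist_order.order_trans suffix_imp_sublist)
  then obtain a b where ab: "sublist s (a @ b)" "(a, b) \<in> C k \<times> W k \<union> W k \<times> C k"
    using short_word_in_two_blocks[of s w "max m (Suc k)" k] w(1) m(3) by auto
  then have len: "length a = 2 ^ k" "length b = 2 ^ k" using length_W C_subset by blast+
  obtain p q where pq: "a @ b = p @ s @ q" using ab(1) by (auto simp: sublist_def)
  then have "length (p @ s @ q) = 2 ^ Suc k" using len by (metis length_append mult_2 power_Suc)
  then have "s = take (length s) (drop (length p) (a @ b))" "length p \<le> 2 ^ Suc k" "length s \<le> 2 ^ Suc k"
    using pq by auto
  then have "s \<in> (\<lambda>(i, j). take j (drop i (a @ b))) ` ({..2 ^ Suc k} \<times> {..2 ^ Suc k})"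
    by (intro image_eqI[of _ _ "(length p, length s)"]) auto
  then show "s \<in> (\<Union>(a, b) \<in> C k \<times> W k \<union> W k \<times> C k. (\<lambda>(i, j). take j (drop i (a @ b))) ` ({..2 ^ Suc k} \<times> {..2 ^ Suc k}))"
    using ab(2) by blast
qed

lemma card_short_words:
  "card {s \<in> lang. length s \<le> 2 ^ k} \<le> 2 * (card (C k) * card (W k)) * (2 ^ Suc k + 1)\<^sup>2"
proof -
  let ?P = "C k \<times> W k \<union> W k \<times> C k"
  let ?S = "\<lambda>(a, b). (\<lambda>(i, j). take j (drop i (a @ b))) ` ({..2 ^ Suc k} \<times> {..2 ^ Suc k})"
  have fin: "finite ?P" using finite_C finite_W by simp
  have "card {s \<in> lang. length s \<le> 2 ^ k} \<le> card (\<Union>ab \<in> ?P. ?S ab)"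
    using short_words_subset by (intro card_mono) (use fin in auto)
  also have "\<dots> \<le> (\<Sum>ab \<in> ?P. card (?S ab))" by (rule card_UN_le[OF fin])
  also have "\<dots> \<le> (\<Sum>ab \<in> ?P. (2 ^ Suc k + 1)\<^sup>2)"
  proof (rule sum_mono, clarify)
    fix a b
    have "card ((\<lambda>(i, j). take j (drop i (a @ b))) ` ({..2 ^ Suc k} \<times> {..2 ^ Suc k})) \<le> card ({..(2::nat) ^ Suc k} \<times> {..(2::nat) ^ Suc k})"
      by (rule card_image_le) simp
    then show "card ((\<lambda>(i, j). take j (drop i (a @ b))) ` ({..2 ^ Suc k} \<times> {..2 ^ Suc k})) \<le> (2 ^ Suc k + 1)\<^sup>2"
      by (simp add: power2_eq_square)
  qed
  also have "\<dots> = card ?P * (2 ^ Suc k + 1)\<^sup>2" by simp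
  also have "card ?P \<le> card (C k \<times> W k) + card (W k \<times> C k)" by (rule card_Un_le)
  also have "\<dots> = 2 * (card (C k) * card (W k))" by (simp add: card_cartesian_product)
  finally show ?thesis by simp
qed

end

section \<open>The block language of a submultiplicative function\<close>

text \<open>The cardinality is about \<open>f (2 ^ Suc k) / f (2 ^ k)\<close>; enough words without \<open>0\<close> are available
  because the construction starts with \<open>2 * f 1\<close> letters other than \<open>0\<close> (\<open>blocks_invariant\<close>).\<close>

definition plain_heads :: "(nat \<Rightarrow> nat) \<Rightarrow> nat \<Rightarrow> nat list set \<Rightarrow> nat list set" where
  "plain_heads f k A = (SOME D. D \<subseteq> {w \<in> A. 0 \<notin> set w} \<and> card D = Suc (f (2 ^ Suc k) div f (2 ^ k)))"

text \<open>Every word is the target of infinitely many even levels. The odd levels have no target, so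
  their heads do not contain \<open>0\<close>.\<close>

definition target :: "nat \<Rightarrow> nat list" where
  "target k = from_nat (fst (prod_decode (k div 2)))"

text \<open>One block ending in the target is enough for primeness, and it raises the number of
  heads by at most 1.\<close>

definition target_head :: "nat \<Rightarrow> nat list set \<Rightarrow> nat list set" where
  "target_head k A = (if even k \<and> (\<exists>w \<in> A. suffix (target k) w)
     then {SOME w. w \<in> A \<and> suffix (target k) w} else {})"

primrec blocks :: "(nat \<Rightarrow> nat) \<Rightarrow> nat \<Rightarrow> nat list set" where
  "blocks f 0 = (\<lambda>a. [a]) ` {..<Suc (2 * f 1)}"
| "blocks f (Suc k) = {c @ w | c w. c \<in> plain_heads f k (blocks f k) \<union> target_head k (blocks f k) \<and> w \<in> blocks f k}"

abbreviation heads :: "(nat \<Rightarrow> nat) \<Rightarrow> nat \<Rightarrow> nat list set" where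
  "heads f k \<equiv> plain_heads f k (blocks f k) \<union> target_head k (blocks f k)"

lemma target_head_subset: "target_head k A \<subseteq> A"
  unfolding target_head_def by (auto intro: someI2_ex)

lemma card_target_head: "card (target_head k A) \<le> 1"
  unfolding target_head_def by simp

text \<open>Equal length of the first parts makes the factorisation unique.\<close>

lemma card_append_image:
  assumes "\<And>c. c \<in> A \<Longrightarrow> length c = n"
  shows "card {c @ w | c w. c \<in> A \<and> w \<in> B} = card A * card B"
proof -
  have "{c @ w | c w. c \<in> A \<and> w \<in> B} = (\<lambda>(c, w). c @ w) ` (A \<times> B)" by auto
  moreover have "inj_on (\<lambda>(c, w). c @ w) (A \<times> B)"
    using assms by (auto simp: inj_on_def)
  ultimately show ?thesis by (simp add: card_image card_cartesian_product)
qed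

lemma exists_pow2: "n \<ge> 1 \<Longrightarrow> \<exists>k. n \<le> 2 ^ k \<and> 2 ^ k < 2 * (n::nat)"
proof -
  assume n: "n \<ge> 1"
  define k where "k = (LEAST k. n \<le> 2 ^ k)"
  have k: "n \<le> 2 ^ k" unfolding k_def by (rule LeastI[of _ n]) simp
  moreover have "2 ^ k < 2 * n"
  proof (cases k)
    case (Suc j)
    then have "\<not> n \<le> 2 ^ j" using not_less_Least[of j "\<lambda>k. n \<le> 2 ^ k"] by (simp add: k_def)
    then show ?thesis using Suc by simp
  qed (use n in simp)
  ultimately show ?thesis by blast
qed

locale submultiplicative =
  fixes f :: "nat \<Rightarrow> nat"
  assumes pos: "\<And>n. n \<ge> 1 \<Longrightarrow> f n \<ge> 1"
    and step_mono: "\<And>n. n \<ge> 1 \<Longrightarrow> f n \<le> f (n + 1)"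
    and submult: "\<And>m n. m \<ge> 1 \<Longrightarrow> n \<ge> 1 \<Longrightarrow> f (m + n) \<le> f m * f n"
begin

lemma mono:
  assumes "1 \<le> m" "m \<le> n"
  shows "f m \<le> f n"
  using assms(2)
proof (induction n rule: dec_induct)
  case (step n)
  then show ?case using step_mono[of n] assms(1) by simp
qed simp

lemma f_pow_pos: "f (2 ^ k) > 0"
  using pos[of "2 ^ k"] by simp

text \<open>By submultiplicativity at \<open>2 ^ k + 2 ^ k\<close> the quotient is at most
  \<open>f (2 ^ k)\<close>; the number of heads demanded therefore fits into a supply of
  \<open>2 * f (2 ^ k)\<close> blocks.\<close>

lemma quota_le: "Suc (f (2 ^ Suc k) div f (2 ^ k)) \<le> 2 * f (2 ^ k)"
proof -
  have "f (2 ^ Suc k) \<le> f (2 ^ k) * f (2 ^ k)" using submult[of "2 ^ k" "2 ^ k"] by (simp add: mult_2)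
  then have "f (2 ^ Suc k) div f (2 ^ k) \<le> f (2 ^ k)" using f_pow_pos
    by (metis div_le_mono nonzero_mult_div_cancel_left not_gr_zero)
  then show ?thesis using f_pow_pos[of k] by simp
qed

text \<open>The supply of blocks without \<open>0\<close> reproduces itself: combining the plain
  heads with \<open>2 * f (2 ^ k)\<close> such blocks gives at least
  \<open>2 * f (2 ^ Suc k)\<close> of the next level. The factor 2 leaves room for the rounded-up
  number of heads in \<open>quota_le\<close>.\<close>

lemma blocks_invariant:
  "finite (blocks f k) \<and> (\<forall>w \<in> blocks f k. length w = 2 ^ k) \<and>
    2 * f (2 ^ k) \<le> card {w \<in> blocks f k. 0 \<notin> set w} \<and>
    plain_heads f k (blocks f k) \<subseteq> {w \<in> blocks f k. 0 \<notin> set w} \<and>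
    card (plain_heads f k (blocks f k)) = Suc (f (2 ^ Suc k) div f (2 ^ k))"
proof -
  \<comment> \<open>The set is chosen by \<open>SOME\<close>, so nothing is known about it until the
    supply is large enough; the fact is therefore conditional and is used both within and after the
    induction.\<close>
  have plain_heads: "plain_heads f k A \<subseteq> {w \<in> A. 0 \<notin> set w} \<and>
      card (plain_heads f k A) = Suc (f (2 ^ Suc k) div f (2 ^ k))"
    if "2 * f (2 ^ k) \<le> card {w \<in> A. 0 \<notin> set w}" for k A
  proof -
    have "\<exists>D. D \<subseteq> {w \<in> A. 0 \<notin> set w} \<and> card D = Suc (f (2 ^ Suc k) div f (2 ^ k))"
      using that quota_le[of k] by (meson obtain_subset_with_card_n order_trans)
    then show ?thesis unfolding plain_heads_def by (rule someI_ex)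
  qed
  have "finite (blocks f k) \<and> (\<forall>w \<in> blocks f k. length w = 2 ^ k) \<and>
    2 * f (2 ^ k) \<le> card {w \<in> blocks f k. 0 \<notin> set w}"
  proof (induction k)
    case 0
    have "{w \<in> blocks f 0. 0 \<notin> set w} = (\<lambda>a. [a]) ` {1..2 * f 1}"
      by (auto simp: less_Suc_eq_le)
    then have "card {w \<in> blocks f 0. 0 \<notin> set w} = 2 * f 1"
      by (simp add: card_image inj_on_def)
    then show ?case by auto
  next
    case (Suc k)
    note c = plain_heads[of k "blocks f k"]
    have sub: "heads f k \<subseteq> blocks f k" using c Suc target_head_subset by fast
    have "blocks f (Suc k) \<subseteq> (\<lambda>(c, w). c @ w) ` (blocks f k \<times> blocks f k)"
      using sub by auto
    then have fin: "finite (blocks f (Suc k))"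
      using Suc by (meson finite_SigmaI finite_imageI finite_subset)
    \<comment> \<open>The \<open>Suc\<close> in the number of heads makes up for the loss in integer
      division.\<close>
    have "f (2 ^ Suc k) \<le> Suc (f (2 ^ Suc k) div f (2 ^ k)) * f (2 ^ k)"
      using f_pow_pos[of k] by (metis dividend_less_div_times less_imp_le_nat mult.commute mult_Suc_right add.commute)
    then have "2 * f (2 ^ Suc k) \<le> card (plain_heads f k (blocks f k)) * (2 * f (2 ^ k))"
      using c Suc by simp
    also have "\<dots> \<le> card (plain_heads f k (blocks f k)) * card {w \<in> blocks f k. 0 \<notin> set w}"
      using Suc by simp
    also have "\<dots> = card {c @ w | c w. c \<in> plain_heads f k (blocks f k) \<and> w \<in> {w \<in> blocks f k. 0 \<notin> set w}}"
      by (rule card_append_image[where n = "2 ^ k", symmetric]) (use c Suc in auto)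
    also have "\<dots> \<le> card {w \<in> blocks f (Suc k). 0 \<notin> set w}"
      by (rule card_mono) (use fin c Suc in auto)
    finally show ?case using fin sub Suc by auto
  qed
  then show ?thesis using plain_heads by blast
qed

sublocale block_language "Suc (2 * f 1)" "blocks f" "heads f"
proof
  show "heads f k \<subseteq> blocks f k" for k
    using blocks_invariant[of k] target_head_subset by fast
  show "heads f k \<noteq> {}" for k
    using blocks_invariant[of k] by (metis Un_empty card.empty nat.distinct(1))
qed simp_all

lemma suffix_target:
  "\<exists>K\<ge>k. (\<exists>w \<in> blocks f K. suffix u w) \<longrightarrow> (\<exists>c \<in> heads f K. suffix u c)"
proof -
  \<comment> \<open>The second component of the pair is a free counter that pushes the level past
    \<open>k\<close>; doubling makes the level even, as targets require.\<close>
  define K where "K = 2 * prod_encode (to_nat u, k)"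
  have "K \<ge> k" using le_prod_encode_2[of k "to_nat u"] by (simp add: K_def)
  moreover have "target K = u" by (simp add: target_def K_def)
  moreover have "\<exists>c \<in> heads f K. suffix u c" if "\<exists>w \<in> blocks f K. suffix u w"
  proof -
    have "(SOME w. w \<in> blocks f K \<and> suffix u w) \<in> target_head K (blocks f K)"
      using that \<open>target K = u\<close> by (auto simp: target_head_def K_def)
    moreover have "suffix u (SOME w. w \<in> blocks f K \<and> suffix u w)"
      using that by (metis (mono_tags, lifting) someI_ex)
    ultimately show ?thesis by blast
  qed
  ultimately show ?thesis by blast
qed

lemma zero_free_heads: "\<exists>k\<ge>i. \<forall>c \<in> heads f k. 0 \<notin> set c"
proof (intro exI conjI)
  show "\<forall>c \<in> heads f (Suc (2 * i)). 0 \<notin> set c"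
    using blocks_invariant[of "Suc (2 * i)"] by (auto simp: target_head_def simp del: blocks.simps)
qed simp

section \<open>Cardinalities of heads and blocks\<close>

lemma card_blocks_lower: "f (2 ^ k) \<le> card (blocks f k)"
proof -
  have "card {w \<in> blocks f k. 0 \<notin> set w} \<le> card (blocks f k)"
    using finite_W by (intro card_mono) auto
  then show ?thesis using blocks_invariant[of k] by linarith
qed

text \<open>Rounding up and the target head add at most 2 to the quotient, and \<open>f\<close> is
  monotone. This gives the factor 3; the weaker factor 4 is convenient because
  \<open>4 ^ Suc k\<close> is the square of the length \<open>2 ^ Suc k\<close>.\<close>

lemma card_heads_mult: "card (heads f k) * f (2 ^ k) \<le> 4 * f (2 ^ Suc k)"
proof -
  have "card (heads f k) \<le> f (2 ^ Suc k) div f (2 ^ k) + 2"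
    using blocks_invariant[of k] card_target_head[of k "blocks f k"]
      card_Un_le[of "plain_heads f k (blocks f k)" "target_head k (blocks f k)"] by linarith
  then have "card (heads f k) * f (2 ^ k) \<le> (f (2 ^ Suc k) div f (2 ^ k)) * f (2 ^ k) + 2 * f (2 ^ k)"
    by (metis add_mult_distrib mult_le_mono1)
  also have "\<dots> \<le> f (2 ^ Suc k) + 2 * f (2 ^ Suc k)"
    by (intro add_mono mult_le_mono2 mono) (auto simp: div_times_less_eq_dividend)
  finally show ?thesis by simp
qed

text \<open>From level to level the ratio of \<open>card (blocks f k)\<close> to
  \<open>f (2 ^ k)\<close> grows at most by the factor 4, so it stays quadratic in the block length;
  the initial ratio is bounded by the number of letters.\<close>

lemma card_heads_blocks:
  "card (heads f k) * card (blocks f k) \<le> Suc (2 * f 1) * 4 ^ Suc k * f (2 ^ Suc k)"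
proof -
  \<comment> \<open>Used twice: as the induction step for the number of blocks, and to derive the
    claim from the resulting bound.\<close>
  have step: "card (heads f k) * card (blocks f k) \<le> Suc (2 * f 1) * 4 ^ Suc k * f (2 ^ Suc k)"
    if "card (blocks f k) \<le> Suc (2 * f 1) * 4 ^ k * f (2 ^ k)" for k
  proof -
    have "card (heads f k) * card (blocks f k) \<le> card (heads f k) * (Suc (2 * f 1) * 4 ^ k * f (2 ^ k))"
      using that by (rule mult_le_mono2)
    also have "\<dots> = Suc (2 * f 1) * 4 ^ k * (card (heads f k) * f (2 ^ k))" by (simp only: mult_ac)
    also have "\<dots> \<le> Suc (2 * f 1) * 4 ^ k * (4 * f (2 ^ Suc k))"
      using card_heads_mult by (rule mult_le_mono2)
    finally show ?thesis by (simp only: mult_ac power_Suc)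
  qed
  have "card (blocks f k) \<le> Suc (2 * f 1) * 4 ^ k * f (2 ^ k)"
  proof (induction k)
    case 0
    have "card (blocks f 0) = Suc (2 * f 1)" by (simp add: card_image inj_on_def del: lessThan_Suc)
    moreover have "Suc (2 * f 1) * 1 \<le> Suc (2 * f 1) * f 1" using pos[of 1] by (intro mult_le_mono2) simp
    ultimately show ?case by (simp only: power_0 mult_1_right)
  next
    case (Suc k)
    have "card (blocks f (Suc k)) = card (heads f k) * card (blocks f k)"
      unfolding blocks.simps
      by (rule card_append_image[where n = "2 ^ k"]) (use C_subset length_W in blast)
    then show ?case using step[OF Suc] by simp
  qed
  then show ?thesis by (rule step)
qed

section \<open>Growth of the language\<close>

lemma finite_short_words: "finite {s \<in> lang. length s \<le> n}"
proof (rule finite_subset)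
  show "{s \<in> lang. length s \<le> n} \<subseteq> {s. set s \<subseteq> {..<Suc (2 * f 1)} \<and> length s \<le> n}"
    using lang_alphabet by blast
qed (rule finite_lists_length_le, simp)

text \<open>Rounding \<open>n\<close> up to a power of 2 below \<open>2 * n\<close> gives a level
  whose blocks alone are numerous enough.\<close>

lemma growth_lower:
  assumes "n \<ge> 1"
  shows "f n \<le> card {s \<in> lang. length s \<le> 2 * n}"
proof -
  obtain k where k: "n \<le> 2 ^ k" "2 ^ k < 2 * n" using exists_pow2[OF assms] by blast
  have "f n \<le> f (2 ^ k)" using k assms by (intro mono)
  also have "\<dots> \<le> card (blocks f k)" by (rule card_blocks_lower)
  also have "\<dots> \<le> card {s \<in> lang. length s \<le> 2 * n}"
    using finite_short_words W_subset_lang length_W k by (intro card_mono) fastforce+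
  finally show ?thesis .
qed

text \<open>With \<open>N = 2 ^ Suc k\<close> at most \<open>4 * n\<close>, one factor
  \<open>N ^ 2\<close> comes from the surplus of blocks and another from the positions of a factor
  in two blocks; together they give the fourth power.\<close>

lemma growth_upper:
  assumes "n \<ge> 1"
  shows "card {s \<in> lang. length s \<le> n} \<le> 8 * Suc (2 * f 1) * (4 * n) ^ 4 * f (4 * n)"
proof -
  obtain k where k: "n \<le> 2 ^ k" "2 ^ k < 2 * n" using exists_pow2[OF assms] by blast
  define N :: nat where "N = 2 ^ Suc k"
  have N: "1 \<le> N" "N \<le> 4 * n" using k by (auto simp: N_def)
  have "card {s \<in> lang. length s \<le> n} \<le> card {s \<in> lang. length s \<le> 2 ^ k}"
    using finite_short_words k by (intro card_mono) auto
  also have "\<dots> \<le> 2 * (card (heads f k) * card (blocks f k)) * (N + 1)\<^sup>2"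
    unfolding N_def by (rule card_short_words)
  also have "\<dots> \<le> 2 * (Suc (2 * f 1) * 4 ^ Suc k * f N) * (2 * N)\<^sup>2"
  proof (rule mult_le_mono[OF mult_le_mono2 power_mono])
    show "card (heads f k) * card (blocks f k) \<le> Suc (2 * f 1) * 4 ^ Suc k * f N"
      unfolding N_def by (rule card_heads_blocks)
  qed (use N in simp_all)
  also have "(4::nat) ^ Suc k = N\<^sup>2"
    unfolding N_def power2_eq_square power_mult_distrib[symmetric] by simp
  also have "2 * (Suc (2 * f 1) * N\<^sup>2 * f N) * (2 * N)\<^sup>2 = 8 * Suc (2 * f 1) * N ^ 4 * f N"
    by (simp add: power2_eq_square power4_eq_xxxx algebra_simps)
  also have "\<dots> \<le> 8 * Suc (2 * f 1) * (4 * n) ^ 4 * f (4 * n)"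
    using N by (intro mult_le_mono power_mono mono order_refl) auto
  finally show ?thesis .
qed

text \<open>Every application of the hypothesis absorbs one more factor \<open>n\<close>, so the
  constant obtained is \<open>C ^ j\<close>.\<close>

lemma absorb_polynomial:
  assumes "C \<ge> 1" "\<And>n. n \<ge> 1 \<Longrightarrow> f (C * n) \<ge> n * f n"
  shows "\<exists>D\<ge>1. \<forall>n\<ge>1. n ^ j * f n \<le> f (D * n)"
proof (induction j)
  case 0
  then show ?case by (intro exI[of _ 1]) simp
next
  case (Suc j)
  then obtain D where D: "D \<ge> 1" "\<forall>n\<ge>1. n ^ j * f n \<le> f (D * n)" by blast
  have "n ^ Suc j * f n \<le> f ((C * D) * n)" if "n \<ge> 1" for n
  proof -
    have "n ^ Suc j * f n = n * (n ^ j * f n)" by simp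
    also have "\<dots> \<le> (D * n) * f (D * n)" using D that by (intro mult_le_mono) auto
    also have "\<dots> \<le> f (C * (D * n))" using assms(2)[of "D * n"] D(1) that by simp
    finally show ?thesis by (simp add: mult.assoc)
  qed
  then show ?case using D(1) assms(1) by (intro exI[of _ "C * D"]) auto
qed

lemma growth_upper_linear:
  assumes "C \<ge> 1" "\<And>n. n \<ge> 1 \<Longrightarrow> f (C * n) \<ge> n * f n"
  shows "\<exists>D\<ge>1. \<forall>n\<ge>1. card {s \<in> lang. length s \<le> n} \<le> f (D * n)"
proof -
  \<comment> \<open>Exponent 5: four powers come from \<open>growth_upper\<close>, and the fifth
    absorbs the constant \<open>E\<close>, which is moved into the argument \<open>?m\<close> for
    this purpose.\<close>
  obtain D where D: "D \<ge> 1" "\<forall>n\<ge>1. n ^ 5 * f n \<le> f (D * n)"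
    using absorb_polynomial[OF assms] by blast
  define E where "E = 8 * Suc (2 * f 1)"
  have "card {s \<in> lang. length s \<le> n} \<le> f ((D * (E * 4)) * n)" if "n \<ge> 1" for n
  proof -
    let ?m = "E * (4 * n)"
    have E: "E \<ge> 1" "4 * n \<le> ?m" "E \<le> ?m" using that by (auto simp: E_def)
    have "card {s \<in> lang. length s \<le> n} \<le> E * (4 * n) ^ 4 * f (4 * n)"
      using growth_upper[OF that] by (simp only: E_def)
    also have "\<dots> \<le> ?m * ?m ^ 4 * f ?m"
    proof (intro mult_le_mono)
      show "(4 * n) ^ 4 \<le> ?m ^ 4" using E(2) by (rule power_mono) simp
      show "f (4 * n) \<le> f ?m" using that by (intro mono E(2)) simp
    qed (rule E(3))
    also have "\<dots> = ?m ^ 5 * f ?m" by (simp add: eval_nat_numeral)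
    also have "\<dots> \<le> f (D * ?m)" using D that E by simp
    finally show ?thesis by (simp add: mult.assoc)
  qed
  then show ?thesis using D(1) by (intro exI[of _ "D * (E * 4)"]) (auto simp: E_def)
qed

end

section \<open>The free algebra\<close>

context field
begin

text \<open>The product is studied for all functions with values in the field, not only those of
  finite support, so that inductions on words can shift functions without support
  conditions.\<close>

definition conv :: "(nat list \<Rightarrow> 'a) \<Rightarrow> (nat list \<Rightarrow> 'a) \<Rightarrow> nat list \<Rightarrow> 'a" where
  "conv p q w = (\<Oplus>i\<in>{..length w}. p (take i w) \<otimes> q (drop i w))"

lemma conv_Nil:
  assumes "p \<in> UNIV \<rightarrow> carrier R" "q \<in> UNIV \<rightarrow> carrier R"
  shows "conv p q [] = p [] \<otimes> q []"
proof -
  have "p [] \<in> carrier R" "q [] \<in> carrier R" using assms by auto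
  then show ?thesis by (simp add: conv_def Pi_def)
qed

text \<open>Splitting off the factorisation with empty left part leaves the convolution of the
  shifted left function; this recursion drives the inductions on words below.\<close>

lemma conv_Cons:
  assumes "p \<in> UNIV \<rightarrow> carrier R" "q \<in> UNIV \<rightarrow> carrier R"
  shows "conv p q (a # w) = p [] \<otimes> q (a # w) \<oplus> conv (\<lambda>v. p (a # v)) q w"
proof -
  have c: "p v \<in> carrier R" "q v \<in> carrier R" for v using assms by auto
  have "conv p q (a # w) = (\<Oplus>i\<in>{..Suc (length w)}. p (take i (a # w)) \<otimes> q (drop i (a # w)))"
    by (simp add: conv_def)
  also have "\<dots> = (\<Oplus>i\<in>{..length w}. p (take (Suc i) (a # w)) \<otimes> q (drop (Suc i) (a # w)))
      \<oplus> p (take 0 (a # w)) \<otimes> q (drop 0 (a # w))"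
    by (rule finsum_Suc2) (simp add: c Pi_def)
  also have "\<dots> = conv (\<lambda>v. p (a # v)) q w \<oplus> p [] \<otimes> q (a # w)"
    by (simp add: conv_def)
  finally show ?thesis
    by (simp add: a_comm c conv_def finsum_closed Pi_def)
qed

lemma conv_closed:
  assumes "p \<in> UNIV \<rightarrow> carrier R" "q \<in> UNIV \<rightarrow> carrier R"
  shows "conv p q w \<in> carrier R"
proof -
  have "p v \<in> carrier R" "q v \<in> carrier R" for v using assms by auto
  then show ?thesis by (simp add: conv_def finsum_closed Pi_def)
qed

lemma conv_closed_Pi:
  "p \<in> UNIV \<rightarrow> carrier R \<Longrightarrow> q \<in> UNIV \<rightarrow> carrier R \<Longrightarrow> conv p q \<in> UNIV \<rightarrow> carrier R"
  using conv_closed by blast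

lemma conv_zero_left:
  assumes "q \<in> UNIV \<rightarrow> carrier R"
  shows "conv (\<lambda>_. \<zero>) q w = \<zero>"
proof -
  have "q v \<in> carrier R" for v using assms by auto
  then show ?thesis by (simp add: conv_def)
qed

lemma conv_add_left:
  assumes "p \<in> UNIV \<rightarrow> carrier R" "q \<in> UNIV \<rightarrow> carrier R" "r \<in> UNIV \<rightarrow> carrier R"
  shows "conv (\<lambda>v. p v \<oplus> q v) r w = conv p r w \<oplus> conv q r w"
proof -
  have "p v \<in> carrier R" "q v \<in> carrier R" "r v \<in> carrier R" for v using assms by auto
  then show ?thesis by (simp add: conv_def l_distr finsum_addf Pi_def)
qed

lemma conv_add_right:
  assumes "p \<in> UNIV \<rightarrow> carrier R" "q \<in> UNIV \<rightarrow> carrier R" "r \<in> UNIV \<rightarrow> carrier R"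
  shows "conv r (\<lambda>v. p v \<oplus> q v) w = conv r p w \<oplus> conv r q w"
proof -
  have "p v \<in> carrier R" "q v \<in> carrier R" "r v \<in> carrier R" for v using assms by auto
  then show ?thesis by (simp add: conv_def r_distr finsum_addf Pi_def)
qed

lemma conv_smult_left:
  assumes "p \<in> UNIV \<rightarrow> carrier R" "q \<in> UNIV \<rightarrow> carrier R" "c \<in> carrier R"
  shows "conv (\<lambda>v. c \<otimes> p v) q w = c \<otimes> conv p q w"
proof -
  have "p v \<in> carrier R" "q v \<in> carrier R" for v using assms by auto
  then show ?thesis using assms(3) by (simp add: conv_def m_assoc finsum_rdistr Pi_def)
qed

lemma conv_smult_right:
  assumes "p \<in> UNIV \<rightarrow> carrier R" "q \<in> UNIV \<rightarrow> carrier R" "c \<in> carrier R"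
  shows "conv p (\<lambda>v. c \<otimes> q v) w = c \<otimes> conv p q w"
proof -
  have "p v \<in> carrier R" "q v \<in> carrier R" for v using assms by auto
  then show ?thesis using assms(3) by (simp add: conv_def m_lcomm finsum_rdistr Pi_def)
qed

text \<open>Deleting the first letter, \<open>p \<mapsto> (\<lambda>v. p (a # v))\<close>, is a twisted derivation for the
  convolution, which turns associativity into an induction on the word.\<close>

lemma conv_assoc:
  assumes "p \<in> UNIV \<rightarrow> carrier R" "q \<in> UNIV \<rightarrow> carrier R" "r \<in> UNIV \<rightarrow> carrier R"
  shows "conv (conv p q) r w = conv p (conv q r) w"
  using assms(1)
proof (induction w arbitrary: p)
  case Nil
  have "p [] \<in> carrier R" "q [] \<in> carrier R" "r [] \<in> carrier R" using Nil assms by auto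
  then show ?case using Nil assms by (simp add: conv_Nil conv_closed_Pi m_assoc)
next
  case (Cons a w)
  define p' q' where "p' = (\<lambda>v. p (a # v))" and "q' = (\<lambda>v. q (a # v))"
  have Pi: "p' \<in> UNIV \<rightarrow> carrier R" "q' \<in> UNIV \<rightarrow> carrier R" using Cons.prems assms by (auto simp: p'_def q'_def)
  have c: "p [] \<in> carrier R" "q [] \<in> carrier R" "r (a # w) \<in> carrier R" using Cons.prems assms by auto
  have "(\<lambda>v. conv p q (a # v)) = (\<lambda>v. p [] \<otimes> q' v \<oplus> conv p' q v)"
    using conv_Cons[OF Cons.prems assms(2)] by (simp add: p'_def q'_def)
  then have "conv (\<lambda>v. conv p q (a # v)) r w = conv (\<lambda>v. p [] \<otimes> q' v) r w \<oplus> conv (conv p' q) r w"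
    using Pi c assms by (simp only:) (intro conv_add_left conv_closed_Pi, auto)
  also have "\<dots> = p [] \<otimes> conv q' r w \<oplus> conv p' (conv q r) w"
    using Pi c assms Cons.IH[OF Pi(1)] by (simp add: conv_smult_left)
  finally have step: "conv (\<lambda>v. conv p q (a # v)) r w = p [] \<otimes> conv q' r w \<oplus> conv p' (conv q r) w" .
  have "conv (conv p q) r (a # w) = conv p q [] \<otimes> r (a # w) \<oplus> conv (\<lambda>v. conv p q (a # v)) r w"
    using Cons.prems assms by (intro conv_Cons conv_closed_Pi)
  also have "\<dots> = p [] \<otimes> (q [] \<otimes> r (a # w)) \<oplus> (p [] \<otimes> conv q' r w \<oplus> conv p' (conv q r) w)"
    using Cons.prems assms c by (simp add: step conv_Nil m_assoc)
  also have "\<dots> = p [] \<otimes> (q [] \<otimes> r (a # w) \<oplus> conv q' r w) \<oplus> conv p' (conv q r) w"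
    using c Pi assms by (simp add: r_distr a_assoc conv_closed conv_closed_Pi)
  also have "\<dots> = p [] \<otimes> conv q r (a # w) \<oplus> conv p' (conv q r) w"
    using assms by (simp add: conv_Cons q'_def)
  also have "\<dots> = conv p (conv q r) (a # w)"
    using Cons.prems assms by (simp add: conv_Cons conv_closed_Pi p'_def)
  finally show ?case .
qed

section \<open>Products with monomials and top coefficients\<close>

lemma monomial_Pi: "monomial R u \<in> UNIV \<rightarrow> carrier R"
  by (auto simp: monomial_def)

lemma conv_monomial_left:
  assumes "p \<in> UNIV \<rightarrow> carrier R"
  shows "conv (monomial R u) p (u @ w) = p w"
    and "\<not> (\<exists>v. w = u @ v) \<Longrightarrow> conv (monomial R u) p w = \<zero>"
proof -
  have c: "p v \<in> carrier R" for v using assms by auto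
  have shift: "(\<lambda>v. monomial R (a # u) (b # v)) = (if a = b then monomial R u else (\<lambda>_. \<zero>))" for a b u
    by (auto simp: monomial_def)
  have nil: "(\<lambda>v. monomial R [] (b # v)) = (\<lambda>_. \<zero>)" "monomial R [] [] = \<one>" "monomial R (a # u) [] = \<zero>" for a b u
    by (auto simp: monomial_def)
  show "conv (monomial R u) p (u @ w) = p w"
  proof (induction u)
    case Nil
    show ?case using assms c
      by (cases w) (simp_all add: conv_Nil conv_Cons monomial_Pi nil conv_zero_left)
  next
    case (Cons a u)
    then show ?case using assms c by (simp add: conv_Cons monomial_Pi nil shift)
  qed
  show "\<not> (\<exists>v. w = u @ v) \<Longrightarrow> conv (monomial R u) p w = \<zero>"
  proof (induction w arbitrary: u)
    case Nil
    then obtain a u' where "u = a # u'" by (cases u) auto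
    then show ?case using assms c by (simp add: conv_Nil monomial_Pi nil)
  next
    case (Cons b w)
    then obtain a u' where u: "u = a # u'" by (cases u) auto
    have "conv (\<lambda>v. monomial R u (b # v)) p w = \<zero>"
      using Cons u assms by (auto simp: shift conv_zero_left)
    then show ?case using assms c u by (simp add: conv_Cons monomial_Pi nil)
  qed
qed

lemma conv_nonzero:
  assumes "p \<in> UNIV \<rightarrow> carrier R" "q \<in> UNIV \<rightarrow> carrier R" "conv p q w \<noteq> \<zero>"
  shows "\<exists>u v. w = u @ v \<and> p u \<noteq> \<zero> \<and> q v \<noteq> \<zero>"
proof (rule ccontr)
  assume *: "\<not> ?thesis"
  have c: "p v \<in> carrier R" "q v \<in> carrier R" for v using assms by auto
  have "p (take i w) \<otimes> q (drop i w) = \<zero>" for i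
    using * c by (metis append_take_drop_id l_null r_null)
  then show False using assms(3) by (simp add: conv_def)
qed

text \<open>In any other factorisation of \<open>s @ t\<close> one part is too long for its support,
  so a single summand remains.\<close>

lemma conv_top:
  assumes "p \<in> UNIV \<rightarrow> carrier R" "q \<in> UNIV \<rightarrow> carrier R"
    and "\<And>v. p v \<noteq> \<zero> \<Longrightarrow> length v \<le> length s" "\<And>v. q v \<noteq> \<zero> \<Longrightarrow> length v \<le> length t"
  shows "conv p q (s @ t) = p s \<otimes> q t"
  using assms(1,3)
proof (induction s arbitrary: p)
  case Nil
  then have p: "p (a # v) = \<zero>" for a v by fastforce
  have c: "p v \<in> carrier R" "q v \<in> carrier R" for v using assms Nil by auto
  show ?case using Nil assms(2) c
    by (cases t) (simp_all add: conv_Nil conv_Cons p conv_zero_left)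
next
  case (Cons a s)
  have c: "p v \<in> carrier R" "q v \<in> carrier R" for v using assms Cons by auto
  have "q (a # s @ t) = \<zero>" using assms(4)[of "a # s @ t"] by fastforce
  moreover have "conv (\<lambda>v. p (a # v)) q (s @ t) = p (a # s) \<otimes> q t"
    using Cons.prems by (intro Cons.IH) fastforce+
  ultimately show ?case using Cons.prems assms(2) c by (simp add: conv_Cons)
qed

section \<open>The ring structure of the free algebra\<close>

abbreviation FA :: "nat \<Rightarrow> ('a, nat list \<Rightarrow> 'a) module" where
  "FA d \<equiv> free_algebra R d"

lemma free_algebra_simps [simp]:
  "mult (FA d) = conv" "one (FA d) = monomial R []" "zero (FA d) = (\<lambda>_. \<zero>)"
  "add (FA d) = (\<lambda>p q w. p w \<oplus> q w)" "smult (FA d) = (\<lambda>c p w. c \<otimes> p w)"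
  by (auto simp: free_algebra_def conv_def monomial_def fun_eq_iff)

lemma free_carrier:
  "p \<in> carrier (FA d) \<longleftrightarrow> p \<in> UNIV \<rightarrow> carrier R \<and> finite {w. p w \<noteq> \<zero>} \<and> {w. p w \<noteq> \<zero>} \<subseteq> lists {..<d}"
  by (simp add: free_algebra_def)

lemma free_carrier_Pi: "p \<in> carrier (FA d) \<Longrightarrow> p \<in> UNIV \<rightarrow> carrier R"
  by (simp add: free_carrier)

lemma free_carrier_coeff: "p \<in> carrier (FA d) \<Longrightarrow> p w \<in> carrier R"
  by (auto simp: free_carrier)

lemma free_carrierI:
  assumes "p \<in> UNIV \<rightarrow> carrier R" "{w. p w \<noteq> \<zero>} \<subseteq> S" "finite S" "S \<subseteq> lists {..<d}"
  shows "p \<in> carrier (FA d)"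
  using assms finite_subset by (auto simp: free_carrier)

lemma conv_closed_free:
  assumes "p \<in> carrier (FA d)" "q \<in> carrier (FA d)"
  shows "conv p q \<in> carrier (FA d)"
proof (rule free_carrierI)
  show "{w. conv p q w \<noteq> \<zero>} \<subseteq> (\<lambda>(u, v). u @ v) ` ({w. p w \<noteq> \<zero>} \<times> {w. q w \<noteq> \<zero>})"
    using conv_nonzero[OF assms[THEN free_carrier_Pi]] by fastforce
  show "(\<lambda>(u, v). u @ v) ` ({w. p w \<noteq> \<zero>} \<times> {w. q w \<noteq> \<zero>}) \<subseteq> lists {..<d}"
    using assms by (fastforce simp: free_carrier)
qed (use assms in \<open>auto simp: free_carrier conv_closed\<close>)

lemma smult_closed_free:
  assumes "c \<in> carrier R" "p \<in> carrier (FA d)"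
  shows "(\<lambda>w. c \<otimes> p w) \<in> carrier (FA d)"
proof (rule free_carrierI)
  show "{w. c \<otimes> p w \<noteq> \<zero>} \<subseteq> {w. p w \<noteq> \<zero>}" using assms by auto
qed (use assms in \<open>auto simp: free_carrier\<close>)

lemma add_closed_free:
  assumes "p \<in> carrier (FA d)" "q \<in> carrier (FA d)"
  shows "(\<lambda>w. p w \<oplus> q w) \<in> carrier (FA d)"
proof (rule free_carrierI)
  show "{w. p w \<oplus> q w \<noteq> \<zero>} \<subseteq> {w. p w \<noteq> \<zero>} \<union> {w. q w \<noteq> \<zero>}" by auto
qed (use assms in \<open>auto simp: free_carrier\<close>)

lemma zero_closed_free: "(\<lambda>_. \<zero>) \<in> carrier (FA d)"
  by (simp add: free_carrier)

lemma monomial_closed_free: "u \<in> lists {..<d} \<Longrightarrow> monomial R u \<in> carrier (FA d)"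
  by (rule free_carrierI[of _ "{u}"]) (auto simp: monomial_def)

lemma free_ring: "ring (FA d)"
proof (rule ringI)
  show "abelian_group (FA d)"
  proof (rule abelian_groupI)
    fix p assume p: "p \<in> carrier (FA d)"
    have "(\<lambda>w. \<ominus> \<one> \<otimes> p w) \<oplus>\<^bsub>FA d\<^esub> p = \<zero>\<^bsub>FA d\<^esub>"
      using free_carrier_coeff[OF p] by (auto simp: fun_eq_iff l_minus l_neg)
    then show "\<exists>y\<in>carrier (FA d). y \<oplus>\<^bsub>FA d\<^esub> p = \<zero>\<^bsub>FA d\<^esub>"
      using smult_closed_free[OF _ p, of "\<ominus> \<one>"] by blast
  qed (simp_all add: fun_eq_iff free_carrier_coeff add_closed_free zero_closed_free a_assoc, simp add: a_comm free_carrier_coeff)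
  have one_left: "conv (monomial R []) p = p" if "p \<in> carrier (FA d)" for p
    using conv_monomial_left(1)[of p "[]"] that by (auto simp: fun_eq_iff free_carrier_Pi)
  have one_right: "conv p (monomial R []) = p" if "p \<in> UNIV \<rightarrow> carrier R" for p
  proof
    fix w show "conv p (monomial R []) w = p w" using that
    proof (induction w arbitrary: p)
      case Nil
      have "p [] \<in> carrier R" using Nil by auto
      then show ?case using Nil by (simp add: conv_Nil monomial_Pi) (simp add: monomial_def)
    next
      case (Cons a w)
      have "p v \<in> carrier R" for v using Cons by auto
      moreover have "conv (\<lambda>v. p (a # v)) (monomial R []) w = p (a # w)" using Cons by (intro Cons.IH) auto
      ultimately show ?case using Cons.prems by (simp add: conv_Cons monomial_Pi) (simp add: monomial_def)
    qed
  qed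
  show "Group.monoid (FA d)"
  proof (rule monoidI)
    show "\<one>\<^bsub>FA d\<^esub> \<in> carrier (FA d)" using monomial_closed_free[of "[]"] by simp
  qed (simp_all add: conv_closed_free one_left one_right free_carrier_Pi, simp add: fun_eq_iff free_carrier_Pi conv_assoc)
qed (simp_all add: fun_eq_iff free_carrier_Pi conv_add_left conv_add_right)

lemma free_uminus:
  assumes "p \<in> carrier (FA d)"
  shows "(\<ominus>\<^bsub>FA d\<^esub> p) w = \<ominus> p w"
proof -
  interpret FA: ring "FA d" by (rule free_ring)
  have "(\<lambda>w. \<ominus> \<one> \<otimes> p w) \<in> carrier (FA d)" using assms by (simp add: smult_closed_free)
  moreover have "(\<lambda>w. \<ominus> \<one> \<otimes> p w) \<oplus>\<^bsub>FA d\<^esub> p = \<zero>\<^bsub>FA d\<^esub>"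
    using free_carrier_coeff[OF assms] by (auto simp: fun_eq_iff l_minus l_neg)
  ultimately have "\<ominus>\<^bsub>FA d\<^esub> p = (\<lambda>w. \<ominus> \<one> \<otimes> p w)"
    using assms by (intro FA.minus_equality)
  then show ?thesis
    using free_carrier_coeff[OF assms] by (simp add: l_minus)
qed

lemma free_minus:
  assumes "q \<in> carrier (FA d)"
  shows "(p \<ominus>\<^bsub>FA d\<^esub> q) w = p w \<ominus> q w"
  using assms by (simp add: a_minus_def free_uminus)

text \<open>Induction on the support. The case \<open>add\<close> only offers words \<open>u\<close>
  from the support of the fixed \<open>p\<close>; in \<open>rels_eq\<close> this is what places
  \<open>u\<close> outside \<open>L\<close>.\<close>

lemma free_induct [consumes 1, case_names zero add]:
  assumes "p \<in> carrier (FA d)"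
    and "P (\<lambda>_. \<zero>)"
    and "\<And>c u q. c \<in> carrier R \<Longrightarrow> p u \<noteq> \<zero> \<Longrightarrow> u \<in> lists {..<d} \<Longrightarrow> q \<in> carrier (FA d) \<Longrightarrow> P q \<Longrightarrow>
      P (\<lambda>w. c \<otimes> monomial R u w \<oplus> q w)"
  shows "P p"
proof -
  have "P q" if "finite S" "S \<subseteq> {w. p w \<noteq> \<zero>}" "{w. q w \<noteq> \<zero>} \<subseteq> S" "q \<in> carrier (FA d)" for q S
    using that
  proof (induction S arbitrary: q rule: finite_induct)
    case empty
    then have "q = (\<lambda>_. \<zero>)" by auto
    then show ?case using assms(2) by simp
  next
    case (insert u S)
    note c = free_carrier_coeff[OF insert.prems(3)]
    define r where "r = (\<lambda>w. if w = u then \<zero> else q w)"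
    have "{w. r w \<noteq> \<zero>} \<subseteq> {w. q w \<noteq> \<zero>}" by (auto simp: r_def)
    then have r: "r \<in> carrier (FA d)"
      using insert.prems(3) c by (intro free_carrierI[of r "{w. q w \<noteq> \<zero>}"]) (auto simp: free_carrier r_def)
    have "P r" using insert.prems by (intro insert.IH r) (auto simp: r_def)
    have "p u \<noteq> \<zero>" "u \<in> lists {..<d}" using insert.prems(1) assms(1) by (auto simp: free_carrier)
    then have "P (\<lambda>w. q u \<otimes> monomial R u w \<oplus> r w)"
      by (intro assms(3) c r \<open>P r\<close>)
    moreover have "q = (\<lambda>w. q u \<otimes> monomial R u w \<oplus> r w)"
      using c by (auto simp: fun_eq_iff r_def monomial_def)
    ultimately show ?case by (rule ssubst[rotated])
  qed
  then show ?thesis using assms(1) by (auto simp: free_carrier)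
qed

end

section \<open>Monomial algebras\<close>

locale monomial_quotient = field R for R (structure) +
  fixes d :: nat and L :: "nat list set"
  assumes L_alphabet: "L \<subseteq> lists {..<d}"
    and L_sublist: "s \<in> L \<Longrightarrow> sublist t s \<Longrightarrow> t \<in> L"
    and L_nonempty: "L \<noteq> {}"
begin

definition rels :: "(nat list \<Rightarrow> 'a) set" where
  "rels = Idl\<^bsub>FA d\<^esub> (monomial R ` (lists {..<d} - L))"

abbreviation "B \<equiv> quotient_algebra (FA d) rels"

abbreviation cl :: "(nat list \<Rightarrow> 'a) \<Rightarrow> (nat list \<Rightarrow> 'a) set" where
  "cl p \<equiv> rels +>\<^bsub>FA d\<^esub> p"

sublocale FA: ring "FA d"
  by (rule free_ring)

lemma Nil_in_L: "[] \<in> L"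
  using L_nonempty L_sublist by (metis all_not_in_conv sublist_Nil_left)

lemma append_L: "u @ v \<in> L \<Longrightarrow> u \<in> L \<and> v \<in> L"
  using L_sublist by (meson sublist_append_leftI sublist_append_rightI)

text \<open>Parts of a word of \<open>L\<close> lie in \<open>L\<close>, so a product with
  \<open>p\<close> that is non-zero on \<open>L\<close> would force \<open>p\<close> to be non-zero
  there.\<close>

lemma vanishing_ideal: "ideal {p \<in> carrier (FA d). \<forall>w \<in> L. p w = \<zero>} (FA d)" (is "ideal ?I _")
proof (rule idealI)
  show "ring (FA d)" by (rule free_ring)
  show "subgroup ?I (add_monoid (FA d))"
  proof (rule FA.add.subgroupI)
    show "?I \<noteq> {}" using zero_closed_free by blast
    fix p assume p: "p \<in> ?I"
    then show "\<ominus>\<^bsub>FA d\<^esub> p \<in> ?I" by (auto simp: free_uminus)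
  qed (auto simp: add_closed_free)
  fix p q assume p: "p \<in> ?I" and q: "q \<in> carrier (FA d)"
  have "conv q p w = \<zero>" "conv p q w = \<zero>" if "w \<in> L" for w
    using that p q conv_nonzero[of q p w] conv_nonzero[of p q w] append_L free_carrier_Pi by blast+
  then show "q \<otimes>\<^bsub>FA d\<^esub> p \<in> ?I" "p \<otimes>\<^bsub>FA d\<^esub> q \<in> ?I"
    using p q by (auto simp: conv_closed_free)
qed

lemma rels_ideal: "ideal rels (FA d)"
  unfolding rels_def by (rule FA.genideal_ideal) (use monomial_closed_free in blast)

sublocale rels: ideal rels "FA d"
  by (rule rels_ideal)

text \<open>Together with \<open>rels_eq\<close>, these rules make the simplifier loop.\<close>

declare rels.a_Hcarr [simp del] rels.Icarr [simp del]

text \<open>Minimality of the generated ideal gives one inclusion; conversely, a polynomial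
  vanishing on \<open>L\<close> is a combination of generators. Equality in the quotient thereby
  becomes equality of coefficients on \<open>L\<close>.\<close>

lemma rels_eq: "rels = {p \<in> carrier (FA d). \<forall>w \<in> L. p w = \<zero>}"
proof
  show "rels \<subseteq> {p \<in> carrier (FA d). \<forall>w \<in> L. p w = \<zero>}"
    unfolding rels_def
  proof (rule FA.genideal_minimal[OF vanishing_ideal], rule image_subsetI)
    fix u assume "u \<in> lists {..<d} - L"
    then show "monomial R u \<in> {p \<in> carrier (FA d). \<forall>w \<in> L. p w = \<zero>}"
      using monomial_closed_free by (auto simp: monomial_def)
  qed
  show "{p \<in> carrier (FA d). \<forall>w \<in> L. p w = \<zero>} \<subseteq> rels"
  proof clarify
    fix p assume p: "p \<in> carrier (FA d)" and van: "\<forall>w \<in> L. p w = \<zero>"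
    from p show "p \<in> rels"
    proof (induction rule: free_induct)
      case zero
      then show ?case using rels.zero_closed by simp
    next
      case (add c u q)
      have "monomial R u \<in> rels"
        using add van FA.genideal_self[of "monomial R ` (lists {..<d} - L)"] monomial_closed_free
        unfolding rels_def by blast
      \<comment> \<open>An ideal is only known to be closed under ring multiplication, so the scalar
        enters as a multiple of the empty word.\<close>
      then have "conv (\<lambda>w. c \<otimes> monomial R [] w) (monomial R u) \<in> rels"
        using rels.I_l_closed[of "monomial R u" "\<lambda>w. c \<otimes> monomial R [] w"] add
        by (simp add: smult_closed_free monomial_closed_free)
      moreover have "conv (\<lambda>w. c \<otimes> monomial R [] w) (monomial R u) = (\<lambda>w. c \<otimes> monomial R u w)"
        using add conv_monomial_left(1)[of "monomial R u" "[]"]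
        by (simp add: fun_eq_iff conv_smult_left monomial_Pi)
      ultimately show ?case using rels.a_closed[of "\<lambda>w. c \<otimes> monomial R u w" q] add van by simp
    qed
  qed
qed

lemma cl_eq_iff:
  assumes "p \<in> carrier (FA d)" "q \<in> carrier (FA d)"
  shows "cl p = cl q \<longleftrightarrow> (\<forall>w \<in> L. p w = q w)"
proof -
  have 1: "(p \<ominus>\<^bsub>FA d\<^esub> q \<in> rels) = (cl p = cl q)"
    by (rule FA.quotient_eq_iff_same_a_r_cos[OF rels_ideal assms])
  have 2: "(p \<ominus>\<^bsub>FA d\<^esub> q \<in> rels) \<longleftrightarrow> (\<forall>w \<in> L. p w \<ominus> q w = \<zero>)"
    using assms FA.minus_closed[OF assms] unfolding rels_eq mem_Collect_eq by (simp only: free_minus simp_thms)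
  have 3: "\<dots> \<longleftrightarrow> (\<forall>w \<in> L. p w = q w)"
    using assms free_carrier_coeff by (simp add: r_right_minus_eq)
  show ?thesis using 1 2 3 by blast
qed

section \<open>Operations of the quotient algebra\<close>

lemma B_carrier: "carrier B = cl ` carrier (FA d)"
  by (auto simp: quotient_algebra_def FactRing_def A_RCOSETS_def')

lemma cl_closed: "p \<in> carrier (FA d) \<Longrightarrow> cl p \<in> carrier B"
  by (simp add: B_carrier)

lemma B_mult: "p \<in> carrier (FA d) \<Longrightarrow> q \<in> carrier (FA d) \<Longrightarrow> cl p \<otimes>\<^bsub>B\<^esub> cl q = cl (conv p q)"
  using rels.rcoset_mult_add[of p q] by (simp add: quotient_algebra_def FactRing_def)

lemma B_add: "p \<in> carrier (FA d) \<Longrightarrow> q \<in> carrier (FA d) \<Longrightarrow> cl p \<oplus>\<^bsub>B\<^esub> cl q = cl (\<lambda>w. p w \<oplus> q w)"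
  using rels.a_rcos_sum[of p q] by (simp add: quotient_algebra_def FactRing_def)

lemma B_one: "\<one>\<^bsub>B\<^esub> = cl (monomial R [])"
  by (simp add: quotient_algebra_def FactRing_def)

lemma B_zero: "\<zero>\<^bsub>B\<^esub> = cl (\<lambda>_. \<zero>)"
proof -
  have "cl \<zero>\<^bsub>FA d\<^esub> = rels" using rels.a_subset FA.a_coset_add_zero by blast
  then show ?thesis by (simp add: quotient_algebra_def FactRing_def)
qed

text \<open>Scalar multiplication is a union over all representatives. They agree on
  \<open>L\<close>, hence yield one coset, and the union is not empty.\<close>

lemma B_smult:
  assumes "c \<in> carrier R" "p \<in> carrier (FA d)"
  shows "c \<odot>\<^bsub>B\<^esub> cl p = cl (\<lambda>w. c \<otimes> p w)"
proof -
  have "cl (\<lambda>w. c \<otimes> x w) = cl (\<lambda>w. c \<otimes> p w)" if x: "x \<in> cl p" for x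
  proof -
    obtain h where "h \<in> rels" "x = h \<oplus>\<^bsub>FA d\<^esub> p" using x unfolding a_r_coset_def' by blast
    then have h: "h \<in> rels" "x = (\<lambda>w. h w \<oplus> p w)" by simp_all
    have "x \<in> carrier (FA d)" using h assms by (simp add: rels_eq add_closed_free)
    moreover have "x w = p w" if "w \<in> L" for w
      using that h assms(2) by (simp add: rels_eq free_carrier_coeff)
    ultimately show ?thesis using assms by (simp add: cl_eq_iff smult_closed_free)
  qed
  moreover have "p \<in> cl p" using assms(2) FA.a_rcosI rels.zero_closed
    by (metis FA.l_zero rels.a_subset)
  ultimately have "(\<Union>x\<in>cl p. cl (\<lambda>w. c \<otimes> x w)) = cl (\<lambda>w. c \<otimes> p w)" by blast
  then show ?thesis by (simp add: quotient_algebra_def)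
qed

lemma B_cases [cases set]:
  assumes "X \<in> carrier B"
  obtains p where "p \<in> carrier (FA d)" "\<And>w. w \<notin> L \<Longrightarrow> p w = \<zero>" "X = cl p"
proof -
  obtain q where q: "q \<in> carrier (FA d)" "X = cl q" using assms by (auto simp: B_carrier)
  define p where "p = (\<lambda>w. if w \<in> L then q w else \<zero>)"
  have "p \<in> carrier (FA d)"
    using q(1) by (intro free_carrierI[of p "{w. q w \<noteq> \<zero>}"]) (auto simp: p_def free_carrier)
  then show ?thesis using that[of p] q by (auto simp: p_def cl_eq_iff)
qed

text \<open>\<open>B\<close> shares its operations with the factor ring but is a different record,
  so the axioms are transferred one by one.\<close>

lemma B_ring: "ring B"
proof -
  interpret Q: ring "FA d Quot rels" by (rule rels.quotient_is_ring)
  have eqs: "carrier B = carrier (FA d Quot rels)" "mult B = mult (FA d Quot rels)"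
    "add B = add (FA d Quot rels)" "one B = one (FA d Quot rels)" "zero B = zero (FA d Quot rels)"
    by (simp_all add: quotient_algebra_def)
  show ?thesis
  proof (rule ringI)
    show "abelian_group B"
      by (rule abelian_groupI) (simp_all add: eqs Q.a_assoc Q.add.l_inv_ex, simp add: Q.a_comm)
    show "Group.monoid B"
      by (rule monoidI) (simp_all add: eqs Q.m_assoc)
  qed (simp_all add: eqs Q.l_distr Q.r_distr)
qed

sublocale B: ring B
  by (rule B_ring)

lemma B_module: "module R B"
proof (rule moduleI)
  show "cring R" ..
  show "abelian_group B" ..
qed (auto elim!: B_cases simp: B_smult B_add smult_closed_free add_closed_free cl_closed cl_eq_iff
    free_carrier_coeff l_distr r_distr m_assoc)

sublocale B: vectorspace R B
  by (simp add: vectorspace_def B_module field_axioms)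

lemma B_smult_mult:
  assumes "c \<in> carrier R" "x \<in> carrier B" "y \<in> carrier B"
  shows "(c \<odot>\<^bsub>B\<^esub> x) \<otimes>\<^bsub>B\<^esub> y = c \<odot>\<^bsub>B\<^esub> (x \<otimes>\<^bsub>B\<^esub> y)"
    and "x \<otimes>\<^bsub>B\<^esub> (c \<odot>\<^bsub>B\<^esub> y) = c \<odot>\<^bsub>B\<^esub> (x \<otimes>\<^bsub>B\<^esub> y)"
proof -
  obtain p q where pq: "p \<in> carrier (FA d)" "x = cl p" "q \<in> carrier (FA d)" "y = cl q"
    using assms by (auto simp: B_carrier)
  have "conv (\<lambda>w. c \<otimes> p w) q = (\<lambda>w. c \<otimes> conv p q w)" "conv p (\<lambda>w. c \<otimes> q w) = (\<lambda>w. c \<otimes> conv p q w)"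
    using pq assms(1) by (simp_all add: fun_eq_iff conv_smult_left conv_smult_right free_carrier_Pi)
  then show "(c \<odot>\<^bsub>B\<^esub> x) \<otimes>\<^bsub>B\<^esub> y = c \<odot>\<^bsub>B\<^esub> (x \<otimes>\<^bsub>B\<^esub> y)" "x \<otimes>\<^bsub>B\<^esub> (c \<odot>\<^bsub>B\<^esub> y) = c \<odot>\<^bsub>B\<^esub> (x \<otimes>\<^bsub>B\<^esub> y)"
    using pq assms(1) by (simp_all add: B_smult B_mult smult_closed_free conv_closed_free)
qed

lemma fg_monomial: "fg_monomial_algebra R B"
  unfolding fg_monomial_algebra_def rels_def
  by (intro exI[of _ d] exI[of _ "lists {..<d} - L"] conjI refl) blast

section \<open>Primeness\<close>

lemma one_not_zero_B: "\<one>\<^bsub>B\<^esub> \<noteq> \<zero>\<^bsub>B\<^esub>"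
  using Nil_in_L by (auto simp: B_one B_zero cl_eq_iff monomial_closed_free zero_closed_free)
    (auto simp: monomial_def)

text \<open>The representative is taken with support in \<open>L\<close>, so that a longest word of
  its support lies in \<open>L\<close> as well.\<close>

lemma nonzero_top:
  assumes "X \<in> carrier B" "X \<noteq> \<zero>\<^bsub>B\<^esub>"
  obtains p u where "p \<in> carrier (FA d)" "X = cl p" "u \<in> L" "p u \<noteq> \<zero>"
    "\<And>w. p w \<noteq> \<zero> \<Longrightarrow> length w \<le> length u"
proof -
  obtain p where p: "p \<in> carrier (FA d)" "\<And>w. w \<notin> L \<Longrightarrow> p w = \<zero>" "X = cl p"
    using B_cases[OF assms(1)] by metis
  let ?S = "{w. p w \<noteq> \<zero>}"
  have "?S \<noteq> {}"
  proof
    assume "?S = {}"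
    then have "p = (\<lambda>_. \<zero>)" by auto
    then show False using assms(2) p(3) by (simp add: B_zero)
  qed
  moreover have fin: "finite ?S" using p(1) by (simp add: free_carrier)
  ultimately have "Max (length ` ?S) \<in> length ` ?S" by (intro Max_in) auto
  then obtain u where u: "u \<in> ?S" "length u = Max (length ` ?S)" by auto
  have "length w \<le> length u" if "w \<in> ?S" for w
    using that fin u(2) by simp
  then show ?thesis using that[of p u] p u(1) by blast
qed

text \<open>For longest words \<open>u\<close> of \<open>X\<close> and \<open>v\<close> of
  \<open>Y\<close>, the coefficient of \<open>u @ w @ v\<close> in the product of \<open>X\<close>,
  \<open>w\<close> and \<open>Y\<close> is the product of two non-zero scalars, and this word
  survives in the quotient.\<close>

lemma prime_B:
  assumes prime: "\<And>u v. u \<in> L \<Longrightarrow> v \<in> L \<Longrightarrow> \<exists>w. u @ w @ v \<in> L"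
  shows "prime_ring B"
  unfolding prime_ring_def
proof (intro conjI allI impI)
  show "ring B" by (rule B_ring)
  show "carrier B \<noteq> {\<zero>\<^bsub>B\<^esub>}" using one_not_zero_B B.one_closed by blast
  fix J K assume *: "ideal J B \<and> ideal K B \<and> J \<cdot>\<^bsub>B\<^esub> K = {\<zero>\<^bsub>B\<^esub>}"
  interpret J: ideal J B using * by blast
  interpret K: ideal K B using * by blast
  show "J = {\<zero>\<^bsub>B\<^esub>} \<or> K = {\<zero>\<^bsub>B\<^esub>}"
  proof (rule ccontr)
    assume "\<not> ?thesis"
    then obtain X Y where X: "X \<in> J" "X \<noteq> \<zero>\<^bsub>B\<^esub>" and Y: "Y \<in> K" "Y \<noteq> \<zero>\<^bsub>B\<^esub>"
      using J.zero_closed K.zero_closed by blast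
    obtain p u where p: "p \<in> carrier (FA d)" "X = cl p" "u \<in> L" "p u \<noteq> \<zero>"
      "\<And>w. p w \<noteq> \<zero> \<Longrightarrow> length w \<le> length u"
      using nonzero_top[OF J.Icarr[OF X(1)] X(2)] by blast
    obtain q v where q: "q \<in> carrier (FA d)" "Y = cl q" "v \<in> L" "q v \<noteq> \<zero>"
      "\<And>w. q w \<noteq> \<zero> \<Longrightarrow> length w \<le> length v"
      using nonzero_top[OF K.Icarr[OF Y(1)] Y(2)] by blast
    obtain w where w: "u @ w @ v \<in> L" using prime p(3) q(3) by blast
    have m: "monomial R w \<in> carrier (FA d)"
      using w L_alphabet append_L by (intro monomial_closed_free) blast
    let ?r = "conv p (monomial R w)"
    have r: "?r \<in> carrier (FA d)" using p m by (simp add: conv_closed_free)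
    have mono_len: "length s \<le> length w" if "monomial R w s \<noteq> \<zero>" for s
      using that by (simp add: monomial_def split: if_splits)
    have "?r (u @ w) = p u \<otimes> monomial R w w"
      using p mono_len by (intro conv_top) (auto simp: free_carrier_Pi monomial_Pi)
    then have ruw: "?r (u @ w) = p u" using p by (simp add: free_carrier_coeff) (simp add: monomial_def free_carrier_coeff)
    \<comment> \<open>The word \<open>u @ w\<close> is again of maximal length, which allows a
      second use of \<open>conv_top\<close>.\<close>
    have r_len: "length s \<le> length (u @ w)" if nz: "?r s \<noteq> \<zero>" for s
    proof -
      obtain s1 s2 where "s = s1 @ s2" "p s1 \<noteq> \<zero>" "monomial R w s2 \<noteq> \<zero>"
        using conv_nonzero[OF free_carrier_Pi[OF p(1)] monomial_Pi nz] by blast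
      then show ?thesis using p(5)[of s1] mono_len[of s2] by simp
    qed
    have "conv ?r q ((u @ w) @ v) = ?r (u @ w) \<otimes> q v"
      using r_len q r p by (intro conv_top) (auto simp: free_carrier_Pi)
    then have "conv ?r q (u @ w @ v) \<noteq> \<zero>"
      using ruw p(4) q(4) integral[of "p u" "q v"] free_carrier_coeff[OF p(1), of u]
        free_carrier_coeff[OF q(1), of v] by auto
    moreover have "(X \<otimes>\<^bsub>B\<^esub> cl (monomial R w)) \<otimes>\<^bsub>B\<^esub> Y \<in> J \<cdot>\<^bsub>B\<^esub> K"
      using X Y m cl_closed J.I_r_closed by (blast intro: ideal_prod.prod)
    then have "cl (conv ?r q) = \<zero>\<^bsub>B\<^esub>" using * p q m r by (simp add: B_mult)
    ultimately show False
      using w p q m r by (auto simp: B_zero cl_eq_iff conv_closed_free zero_closed_free)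
  qed
qed

section \<open>The locally nilpotent ideal\<close>

definition marked_ideal :: "(nat list \<Rightarrow> 'a) set set" where
  "marked_ideal = {cl p | p. p \<in> carrier (FA d) \<and> (\<forall>w. p w \<noteq> \<zero> \<longrightarrow> 0 \<in> set w)}"

lemma marked_idealI:
  "p \<in> carrier (FA d) \<Longrightarrow> (\<And>w. p w \<noteq> \<zero> \<Longrightarrow> 0 \<in> set w) \<Longrightarrow> cl p \<in> marked_ideal"
  unfolding marked_ideal_def by blast

lemma marked_idealE:
  assumes "X \<in> marked_ideal"
  obtains p where "p \<in> carrier (FA d)" "\<And>w. p w \<noteq> \<zero> \<Longrightarrow> 0 \<in> set w" "X = cl p"
  using assms unfolding marked_ideal_def by blast

text \<open>A word contains \<open>0\<close> as soon as one of its factors does, so the condition on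
  a representative survives multiplication on both sides.\<close>

lemma marked_ideal_ideal: "ideal marked_ideal B"
proof (rule idealI)
  show "ring B" by (rule B_ring)
  have sub: "marked_ideal \<subseteq> carrier B" by (auto simp: marked_ideal_def cl_closed)
  show "subgroup marked_ideal (add_monoid B)"
  proof (rule B.add.subgroupI)
    show "marked_ideal \<subseteq> carrier B" by (rule sub)
    show "marked_ideal \<noteq> {}" using marked_idealI[OF zero_closed_free] by blast
    fix X assume X: "X \<in> marked_ideal"
    then obtain p where p: "p \<in> carrier (FA d)" "\<And>w. p w \<noteq> \<zero> \<Longrightarrow> 0 \<in> set w" "X = cl p"
      using marked_idealE by metis
    have "\<ominus>\<^bsub>B\<^esub> X = (\<ominus> \<one>) \<odot>\<^bsub>B\<^esub> X"
      using X sub B.smult_l_minus[of \<one> X] by auto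
    also have "\<dots> = cl (\<lambda>w. \<ominus> \<one> \<otimes> p w)" using p by (simp add: B_smult)
    also have "\<dots> \<in> marked_ideal"
    proof (rule marked_idealI)
      fix w assume "\<ominus> \<one> \<otimes> p w \<noteq> \<zero>"
      then have "p w \<noteq> \<zero>" by auto
      then show "0 \<in> set w" by (rule p(2))
    qed (use p in \<open>simp add: smult_closed_free\<close>)
    finally show "\<ominus>\<^bsub>B\<^esub> X \<in> marked_ideal" .
  next
    fix X Y assume "X \<in> marked_ideal" "Y \<in> marked_ideal"
    then obtain p q where pq: "p \<in> carrier (FA d)" "\<And>w. p w \<noteq> \<zero> \<Longrightarrow> 0 \<in> set w" "X = cl p"
        "q \<in> carrier (FA d)" "\<And>w. q w \<noteq> \<zero> \<Longrightarrow> 0 \<in> set w" "Y = cl q"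
      using marked_idealE by metis
    have "cl (\<lambda>w. p w \<oplus> q w) \<in> marked_ideal"
    proof (rule marked_idealI)
      fix w assume "p w \<oplus> q w \<noteq> \<zero>"
      then have "p w \<noteq> \<zero> \<or> q w \<noteq> \<zero>" by auto
      then show "0 \<in> set w" using pq(2,5) by blast
    qed (use pq in \<open>simp add: add_closed_free\<close>)
    then show "X \<oplus>\<^bsub>B\<^esub> Y \<in> marked_ideal" using pq by (simp add: B_add)
  qed
  fix X Y assume "X \<in> marked_ideal" "Y \<in> carrier B"
  then obtain p q where pq: "p \<in> carrier (FA d)" "\<And>w. p w \<noteq> \<zero> \<Longrightarrow> 0 \<in> set w" "X = cl p"
      "q \<in> carrier (FA d)" "Y = cl q"
    using marked_idealE B_cases by metis
  have "0 \<in> set w" if "conv q p w \<noteq> \<zero>" for w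
    using conv_nonzero[OF _ _ that] pq(1,4) pq(2) free_carrier_Pi by fastforce
  moreover have "0 \<in> set w" if "conv p q w \<noteq> \<zero>" for w
    using conv_nonzero[OF _ _ that] pq(1,4) pq(2) free_carrier_Pi by fastforce
  ultimately show "Y \<otimes>\<^bsub>B\<^esub> X \<in> marked_ideal" "X \<otimes>\<^bsub>B\<^esub> Y \<in> marked_ideal"
    using pq by (simp_all add: B_mult conv_closed_free marked_idealI)
qed

lemma marked_ideal_nonzero:
  assumes "[0] \<in> L"
  shows "marked_ideal \<noteq> {\<zero>\<^bsub>B\<^esub>}"
proof -
  have m: "monomial R [0] \<in> carrier (FA d)" using assms L_alphabet by (intro monomial_closed_free) auto
  moreover have "\<forall>w. monomial R [0] w \<noteq> \<zero> \<longrightarrow> 0 \<in> set w" by (simp add: monomial_def)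
  ultimately have "cl (monomial R [0]) \<in> marked_ideal" unfolding marked_ideal_def by blast
  moreover have "cl (monomial R [0]) \<noteq> \<zero>\<^bsub>B\<^esub>"
    using assms m by (auto simp: B_zero cl_eq_iff zero_closed_free) (auto simp: monomial_def)
  ultimately show ?thesis by blast
qed

text \<open>Representatives of finitely many elements involve only words of some bounded length
  \<open>k\<close>, each containing \<open>0\<close>. Words of an \<open>n\<close>-fold product are
  concatenations of \<open>n\<close> of these and so lie outside \<open>L\<close>.\<close>

lemma marked_ideal_locally_nilpotent:
  assumes sparse: "\<And>k. \<exists>n\<ge>1. \<forall>xs. length xs = n \<longrightarrow>
    (\<forall>x \<in> set xs. 0 \<in> set x \<and> length x \<le> k) \<longrightarrow> concat xs \<notin> L"
  shows "locally_nilpotent B marked_ideal"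
  unfolding locally_nilpotent_def
proof (intro allI impI)
  fix S assume S: "finite S \<and> S \<subseteq> marked_ideal"
  have "\<forall>X \<in> S. \<exists>p. p \<in> carrier (FA d) \<and> (\<forall>w. p w \<noteq> \<zero> \<longrightarrow> 0 \<in> set w) \<and> X = cl p"
    using S by (auto simp: marked_ideal_def)
  then obtain P where P: "\<And>X. X \<in> S \<Longrightarrow> P X \<in> carrier (FA d)"
    "\<And>X w. X \<in> S \<Longrightarrow> P X w \<noteq> \<zero> \<Longrightarrow> 0 \<in> set w" "\<And>X. X \<in> S \<Longrightarrow> X = cl (P X)" by metis
  let ?W = "\<Union>X \<in> S. {w. P X w \<noteq> \<zero>}"
  have "finite ?W" using S P(1) by (auto simp: free_carrier)
  then obtain k where k: "\<forall>w \<in> ?W. length w \<le> k"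
    using finite_nat_set_iff_bounded_le[of "length ` ?W"] by auto
  obtain n where n: "n \<ge> 1" "\<And>xs. length xs = n \<Longrightarrow> (\<forall>x \<in> set xs. 0 \<in> set x \<and> length x \<le> k) \<Longrightarrow> concat xs \<notin> L"
    using sparse[of k] by blast
  \<comment> \<open>The support is a property of the representative and not of its class, so a
    representative is carried along.\<close>
  have prod: "\<exists>r \<in> carrier (FA d). foldr (mult B) Xs \<one>\<^bsub>B\<^esub> = cl r \<and>
      (\<forall>w. r w \<noteq> \<zero> \<longrightarrow> (\<exists>xs. w = concat xs \<and> length xs = length Xs \<and>
        (\<forall>x \<in> set xs. 0 \<in> set x \<and> length x \<le> k)))" if "set Xs \<subseteq> S" for Xs
    using that
  proof (induction Xs)
    case Nil
    have "monomial R [] \<in> carrier (FA d)" by (simp add: monomial_closed_free)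
    then show ?case by (rule bexI[rotated]) (auto simp: B_one, simp add: monomial_def split: if_splits)
  next
    case (Cons X Xs)
    then obtain r where r: "r \<in> carrier (FA d)" "foldr (mult B) Xs \<one>\<^bsub>B\<^esub> = cl r"
      "\<And>w. r w \<noteq> \<zero> \<Longrightarrow> \<exists>xs. w = concat xs \<and> length xs = length Xs \<and>
        (\<forall>x \<in> set xs. 0 \<in> set x \<and> length x \<le> k)" by auto
    have X: "X \<in> S" using Cons.prems by simp
    show ?case
    proof (intro bexI[of _ "conv (P X) r"] conjI allI impI)
      show "foldr (mult B) (X # Xs) \<one>\<^bsub>B\<^esub> = cl (conv (P X) r)"
        using r B_mult[OF P(1)[OF X] r(1)] P(3)[OF X] by simp
      show "conv (P X) r \<in> carrier (FA d)" using P(1)[OF X] r(1) by (rule conv_closed_free)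
      fix w assume "conv (P X) r w \<noteq> \<zero>"
      then obtain u v where uv: "w = u @ v" "P X u \<noteq> \<zero>" "r v \<noteq> \<zero>"
        using conv_nonzero P(1)[OF X] r(1) free_carrier_Pi by blast
      obtain xs where "v = concat xs" "length xs = length Xs" "\<forall>x \<in> set xs. 0 \<in> set x \<and> length x \<le> k"
        using r(3)[OF uv(3)] by blast
      moreover have "0 \<in> set u" "length u \<le> k" using P(2)[OF X uv(2)] k X uv(2) by auto
      ultimately show "\<exists>xs. w = concat xs \<and> length xs = length (X # Xs) \<and>
        (\<forall>x \<in> set xs. 0 \<in> set x \<and> length x \<le> k)"
        using uv(1) by (intro exI[of _ "u # xs"]) auto
    qed
  qed
  have "foldr (mult B) Xs \<one>\<^bsub>B\<^esub> = \<zero>\<^bsub>B\<^esub>" if Xs: "set Xs \<subseteq> S" "length Xs = n" for Xs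
  proof -
    obtain r where r: "r \<in> carrier (FA d)" "foldr (mult B) Xs \<one>\<^bsub>B\<^esub> = cl r"
      "\<forall>w. r w \<noteq> \<zero> \<longrightarrow> (\<exists>xs. w = concat xs \<and> length xs = length Xs \<and>
        (\<forall>x \<in> set xs. 0 \<in> set x \<and> length x \<le> k))" using prod[OF Xs(1)] by blast
    have "r w = \<zero>" if "w \<in> L" for w
      using r(3) n(2) Xs(2) that by metis
    then show ?thesis using r by (simp add: B_zero cl_eq_iff zero_closed_free)
  qed
  then show "\<exists>n\<ge>1. n_fold_products B S n \<subseteq> {\<zero>\<^bsub>B\<^esub>}"
    using n(1) unfolding n_fold_products_def by blast
qed

end

section \<open>Growth of monomial algebras\<close>

text \<open>Independent subsets of \<open>U\<close> stay independent in \<open>W\<close>, which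
  bounds their size; a maximal one is a basis of \<open>U\<close>.\<close>

lemma (in vectorspace) subspace_fin_dim_mono:
  assumes "subspace K U V" "subspace K W V" "U \<subseteq> W" "vectorspace.fin_dim K (vs W)"
  shows "vectorspace.fin_dim K (vs U)" "vectorspace.dim K (vs U) \<le> vectorspace.dim K (vs W)"
proof -
  interpret U: vectorspace K "vs U" using assms(1) by (rule subspace_is_vs)
  interpret W: vectorspace K "vs W" using assms(2) by (rule subspace_is_vs)
  have li: "finite A \<and> card A \<le> W.dim" if "A \<subseteq> carrier (vs U) \<and> U.lin_indpt A" for A
  proof -
    have "\<not> lin_dep A" "A \<subseteq> W"
      using that span_li_not_depend(2)[of A U] assms(1,3) by auto
    then have "W.lin_indpt A"
      using span_li_not_depend(2)[of A W] assms(2) by auto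
    then show ?thesis using W.li_le_dim[of A] assms(4) \<open>A \<subseteq> W\<close> by simp
  qed
  have "{} \<subseteq> carrier (vs U) \<and> U.lin_indpt {}" by (auto simp: U.lin_dep_def)
  then obtain A where A: "finite A" "maximal A (\<lambda>S. S \<subseteq> carrier (vs U) \<and> U.lin_indpt S)"
    using maximal_exists[of "\<lambda>S. S \<subseteq> carrier (vs U) \<and> U.lin_indpt S" W.dim "{}"] li by blast
  then have basis: "U.basis A" using U.max_li_is_basis by blast
  then show "U.fin_dim" using A(1) unfolding U.fin_dim_def U.basis_def by blast
  have "U.dim = card A" using A(1) basis by (rule U.dim_basis)
  also have "\<dots> \<le> W.dim" using li basis unfolding U.basis_def by blast
  finally show "U.dim \<le> W.dim" .
qed

lemma growth_space_mono:
  assumes "module F B" "m \<le> n"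
  shows "growth_space F B V m \<subseteq> growth_space F B V n"
  unfolding growth_space_def using assms(2)
  by (intro module.span_is_monotone[OF assms(1)] UN_mono) auto

context monomial_quotient
begin

text \<open>The filtration by degree, which serves as the reference for all generating
  subspaces.\<close>

definition short :: "nat \<Rightarrow> (nat list \<Rightarrow> 'a) set set" where
  "short n = {cl p | p. p \<in> carrier (FA d) \<and> (\<forall>w. p w \<noteq> \<zero> \<longrightarrow> length w \<le> n)}"

abbreviation short_words :: "nat \<Rightarrow> nat list set" where
  "short_words n \<equiv> {w \<in> L. length w \<le> n}"

abbreviation word :: "nat list \<Rightarrow> (nat list \<Rightarrow> 'a) set" where
  "word w \<equiv> cl (monomial R w)"

lemma shortI:
  "p \<in> carrier (FA d) \<Longrightarrow> (\<And>w. p w \<noteq> \<zero> \<Longrightarrow> length w \<le> n) \<Longrightarrow> cl p \<in> short n"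
  unfolding short_def by blast

lemma shortE:
  assumes "X \<in> short n"
  obtains p where "p \<in> carrier (FA d)" "\<And>w. p w \<noteq> \<zero> \<Longrightarrow> length w \<le> n" "X = cl p"
  using assms unfolding short_def by blast

lemma short_subset: "short n \<subseteq> carrier B"
  by (auto simp: short_def cl_closed)

lemma short_mono: "m \<le> n \<Longrightarrow> short m \<subseteq> short n"
  unfolding short_def using order_trans by blast

lemma word_closed: "w \<in> L \<Longrightarrow> word w \<in> carrier B"
  using L_alphabet by (auto intro!: cl_closed monomial_closed_free)

lemma word_Cons:
  assumes "a # w \<in> lists {..<d}"
  shows "word (a # w) = word [a] \<otimes>\<^bsub>B\<^esub> word w"
proof -
  have "conv (monomial R [a]) (monomial R w) v = monomial R (a # w) v" for v
  proof (cases "\<exists>u. v = [a] @ u")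
    case True
    then obtain u where "v = [a] @ u" by blast
    then show ?thesis
      using conv_monomial_left(1)[OF monomial_Pi, of "[a]" w u] by (simp add: monomial_def)
  next
    case False
    then show ?thesis
      using conv_monomial_left(2)[OF monomial_Pi False] by (auto simp: monomial_def)
  qed
  then have "conv (monomial R [a]) (monomial R w) = monomial R (a # w)" by blast
  then show ?thesis using assms by (simp add: B_mult monomial_closed_free)
qed

lemma short_submodule: "LinearCombinations.submodule R (short n) B"
proof (rule LinearCombinations.submodule.intro)
  show "module R B" by (rule B_module)
  show "short n \<subseteq> carrier B" by (rule short_subset)
  show "\<zero>\<^bsub>B\<^esub> \<in> short n" unfolding B_zero by (rule shortI) (simp_all add: zero_closed_free)
next
  fix X Y assume "X \<in> short n" "Y \<in> short n"
  then obtain p q where pq: "p \<in> carrier (FA d)" "\<And>w. p w \<noteq> \<zero> \<Longrightarrow> length w \<le> n" "X = cl p"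
      "q \<in> carrier (FA d)" "\<And>w. q w \<noteq> \<zero> \<Longrightarrow> length w \<le> n" "Y = cl q"
    using shortE by metis
  have "cl (\<lambda>w. p w \<oplus> q w) \<in> short n"
  proof (rule shortI)
    fix w assume "p w \<oplus> q w \<noteq> \<zero>"
    then have "p w \<noteq> \<zero> \<or> q w \<noteq> \<zero>" by auto
    then show "length w \<le> n" using pq(2,5) by blast
  qed (use pq in \<open>simp add: add_closed_free\<close>)
  then show "X \<oplus>\<^bsub>B\<^esub> Y \<in> short n" using pq by (simp add: B_add)
next
  fix c X assume c: "c \<in> carrier R" and "X \<in> short n"
  then obtain p where p: "p \<in> carrier (FA d)" "\<And>w. p w \<noteq> \<zero> \<Longrightarrow> length w \<le> n" "X = cl p"
    using shortE by metis
  have "cl (\<lambda>w. c \<otimes> p w) \<in> short n"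
  proof (rule shortI)
    fix w assume "c \<otimes> p w \<noteq> \<zero>"
    then have "p w \<noteq> \<zero>" using c by auto
    then show "length w \<le> n" by (rule p(2))
  qed (use p c in \<open>simp add: smult_closed_free\<close>)
  then show "c \<odot>\<^bsub>B\<^esub> X \<in> short n" using p c by (simp add: B_smult)
qed

lemma short_subspace: "VectorSpace.subspace R (short n) B"
  using short_submodule by (simp add: VectorSpace.subspace_def B.vectorspace_axioms)

lemma short_mult:
  assumes "X \<in> short m" "Y \<in> short n"
  shows "X \<otimes>\<^bsub>B\<^esub> Y \<in> short (m + n)"
proof -
  obtain p q where pq: "p \<in> carrier (FA d)" "\<And>w. p w \<noteq> \<zero> \<Longrightarrow> length w \<le> m" "X = cl p"
      "q \<in> carrier (FA d)" "\<And>w. q w \<noteq> \<zero> \<Longrightarrow> length w \<le> n" "Y = cl q"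
    using assms shortE by metis
  have "cl (conv p q) \<in> short (m + n)"
  proof (rule shortI)
    fix w assume nz: "conv p q w \<noteq> \<zero>"
    obtain u v where "w = u @ v" "p u \<noteq> \<zero>" "q v \<noteq> \<zero>"
      using conv_nonzero[OF _ _ nz] pq(1,4) free_carrier_Pi by blast
    then show "length w \<le> m + n" using pq(2)[of u] pq(5)[of v] by simp
  qed (use pq in \<open>simp add: conv_closed_free\<close>)
  then show ?thesis using pq by (simp add: B_mult)
qed

lemma carrier_short: "X \<in> carrier B \<Longrightarrow> \<exists>n. X \<in> short n"
proof -
  assume "X \<in> carrier B"
  then obtain p where p: "p \<in> carrier (FA d)" "X = cl p" by (auto simp: B_carrier)
  then obtain n where "\<forall>l \<in> length ` {w. p w \<noteq> \<zero>}. l \<le> n"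
    using finite_nat_set_iff_bounded_le[of "length ` {w. p w \<noteq> \<zero>}"] by (auto simp: free_carrier)
  then have "X \<in> short n" unfolding p(2) using p(1) by (intro shortI) auto
  then show ?thesis by blast
qed

section \<open>Words as a basis\<close>

lemma finite_short_words: "finite (short_words n)"
proof (rule finite_subset)
  show "short_words n \<subseteq> {s. set s \<subseteq> {..<d} \<and> length s \<le> n}" using L_alphabet by blast
qed (rule finite_lists_length_le, simp)

lemma inj_word: "inj_on word L"
proof (rule inj_onI)
  fix u v assume uv: "u \<in> L" "v \<in> L" "word u = word v"
  then have "\<forall>w \<in> L. monomial R u w = monomial R v w"
    using L_alphabet by (subst (asm) cl_eq_iff) (auto intro!: monomial_closed_free)
  then have "monomial R u u = monomial R v u" using uv by blast
  then show "u = v" by (simp add: monomial_def split: if_splits)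
qed

text \<open>By \<open>inj_word\<close> distinct words of \<open>L\<close> have distinct classes, so
  the combination has one polynomial representative; its membership in the free algebra is what
  \<open>cl_eq_iff\<close> needs later.\<close>

lemma lincomb_word:
  assumes "finite S" "S \<subseteq> L" "a \<in> word ` S \<rightarrow> carrier R"
  shows "B.lincomb a (word ` S) = cl (\<lambda>w. if w \<in> S then a (word w) else \<zero>)
    \<and> (\<lambda>w. if w \<in> S then a (word w) else \<zero>) \<in> carrier (FA d)"
  using assms
proof (induction S rule: finite_induct)
  case empty
  then show ?case by (simp add: B.lincomb_def B_zero zero_closed_free)
next
  case (insert u S)
  let ?p = "\<lambda>S w. if w \<in> S then a (word w) else \<zero>"
  have "word u \<notin> word ` S"
    using inj_on_image_mem_iff[OF inj_word, of u S] insert.hyps(2) insert.prems(1) by blast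
  moreover have "word u \<in> carrier B" "word ` S \<subseteq> carrier B"
    using insert.prems(1) word_closed by blast+
  moreover have "a (word u) \<in> carrier R" using insert.prems(2) by blast
  moreover have "monomial R u \<in> carrier (FA d)"
    using insert.prems(1) L_alphabet by (intro monomial_closed_free) blast
  ultimately have u: "word u \<notin> word ` S" "word u \<in> carrier B" "word ` S \<subseteq> carrier B"
      "a (word u) \<in> carrier R" "monomial R u \<in> carrier (FA d)" by blast+
  have IH: "B.lincomb a (word ` S) = cl (?p S)" "?p S \<in> carrier (FA d)"
    using insert by auto
  have split: "?p (insert u S) = (\<lambda>w. a (word u) \<otimes> monomial R u w \<oplus> ?p S w)"
  proof
    fix w
    have m: "monomial R u w = (if w = u then \<one> else \<zero>)" by (simp add: monomial_def)
    have "w \<in> S \<Longrightarrow> a (word w) \<in> carrier R" using insert.prems(2) by blast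
    then show "?p (insert u S) w = a (word u) \<otimes> monomial R u w \<oplus> ?p S w"
      unfolding m using insert.hyps(2) u(4) by auto
  qed
  have "B.lincomb a (word ` S \<union> {word u}) = a (word u) \<odot>\<^bsub>B\<^esub> word u \<oplus>\<^bsub>B\<^esub> B.lincomb a (word ` S)"
    using insert u by (intro B.lincomb_insert) auto
  also have "\<dots> = cl (?p (insert u S))"
    unfolding IH(1) split using u IH(2) by (simp add: B_smult B_add smult_closed_free)
  finally have "B.lincomb a (word ` insert u S) = cl (?p (insert u S))" by simp
  moreover have "?p (insert u S) \<in> carrier (FA d)"
    unfolding split using u IH(2) by (simp add: add_closed_free smult_closed_free)
  ultimately show ?case by blast
qed

lemma word_lin_indpt:
  assumes "finite S" "S \<subseteq> L"
  shows "B.lin_indpt (word ` S)"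
proof (rule B.finite_lin_indpt2)
  show "finite (word ` S)" "word ` S \<subseteq> carrier B" using assms word_closed by auto
  fix a assume a: "a \<in> word ` S \<rightarrow> carrier R" "B.lincomb a (word ` S) = \<zero>\<^bsub>B\<^esub>"
  note l = lincomb_word[OF assms a(1)]
  have "cl (\<lambda>w. if w \<in> S then a (word w) else \<zero>) = cl (\<lambda>_. \<zero>)"
    using l a(2) by (simp only: B_zero)
  then have "\<forall>w \<in> L. (if w \<in> S then a (word w) else \<zero>) = \<zero>"
    using cl_eq_iff[OF conjunct2[OF l] zero_closed_free] by simp
  then have "a (word v) = \<zero>" if "v \<in> S" for v
    using that assms(2) by (metis subsetD)
  then show "\<forall>v \<in> word ` S. a v = \<zero>" by blast
qed

lemma span_word: "B.span (word ` short_words n) = short n"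
proof
  have "word ` short_words n \<subseteq> short n"
  proof clarify
    fix w assume "w \<in> L" "length w \<le> n"
    then show "word w \<in> short n"
      using L_alphabet by (intro shortI monomial_closed_free) (auto simp: monomial_def split: if_splits)
  qed
  then show "B.span (word ` short_words n) \<subseteq> short n"
    using short_submodule by (rule B.span_is_subset)
  show "short n \<subseteq> B.span (word ` short_words n)"
  proof
    fix X assume "X \<in> short n"
    then obtain p where p: "p \<in> carrier (FA d)" "\<And>w. p w \<noteq> \<zero> \<Longrightarrow> length w \<le> n" "X = cl p"
      by (rule shortE) blast
    \<comment> \<open>Coefficients have to be indexed by classes; injectivity recovers the word from
      its class.\<close>
    define a where "a X = p (inv_into L word X)" for X
    have a: "a (word w) = p w" if "w \<in> L" for w
      using inv_into_f_f[OF inj_word that] by (simp add: a_def)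
    have Pi: "a \<in> word ` short_words n \<rightarrow> carrier R" using free_carrier_coeff[OF p(1)] by (simp add: a_def)
    have l: "B.lincomb a (word ` short_words n) = cl (\<lambda>w. if w \<in> short_words n then a (word w) else \<zero>)"
        "(\<lambda>w. if w \<in> short_words n then a (word w) else \<zero>) \<in> carrier (FA d)"
      using lincomb_word[OF finite_short_words _ Pi] by blast+
    have "(if w \<in> short_words n then a (word w) else \<zero>) = p w" if "w \<in> L" for w
      using a[OF that] p(2)[of w] that by (cases "p w = \<zero>") auto
    then have "B.lincomb a (word ` short_words n) = X"
      unfolding l(1) p(3) using cl_eq_iff[OF l(2) p(1)] by blast
    then show "X \<in> B.span (word ` short_words n)"
      unfolding B.span_def using finite_short_words Pi by blast
  qed
qed

lemma dim_short:
  "vectorspace.fin_dim R (B\<lparr>carrier := short n\<rparr>)"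
  "vectorspace.dim R (B\<lparr>carrier := short n\<rparr>) = card (short_words n)"
proof -
  interpret S: vectorspace R "B\<lparr>carrier := short n\<rparr>"
    using short_subspace by (rule B.subspace_is_vs)
  have fin: "finite (word ` short_words n)" using finite_short_words by simp
  have sub: "word ` short_words n \<subseteq> short n"
    using B.in_own_span[of "word ` short_words n"] word_closed span_word by blast
  have "S.lin_indpt (word ` short_words n)" "S.span (word ` short_words n) = short n"
    using B.span_li_not_depend[OF sub short_submodule] word_lin_indpt[OF finite_short_words] span_word
    by auto
  then have "S.basis (word ` short_words n)" using sub by (simp add: S.basis_def)
  then show "S.fin_dim" "S.dim = card (short_words n)"
    using fin S.dim_basis card_image[OF inj_on_subset[OF inj_word]] sub
    by (auto simp: S.basis_def S.fin_dim_def)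
qed

section \<open>Growth spaces of an arbitrary generating subspace\<close>

lemma submoduleI:
  assumes "H \<subseteq> carrier B" "\<zero>\<^bsub>B\<^esub> \<in> H"
    "\<And>x y. x \<in> H \<Longrightarrow> y \<in> H \<Longrightarrow> x \<oplus>\<^bsub>B\<^esub> y \<in> H"
    "\<And>c x. c \<in> carrier R \<Longrightarrow> x \<in> H \<Longrightarrow> c \<odot>\<^bsub>B\<^esub> x \<in> H"
  shows "LinearCombinations.submodule R H B"
  using assms B_module by (intro LinearCombinations.submodule.intro)

lemma products_closed:
  assumes "V \<subseteq> carrier B"
  shows "n_fold_products B V n \<subseteq> carrier B"
proof -
  have "foldr (mult B) xs \<one>\<^bsub>B\<^esub> \<in> carrier B" if "set xs \<subseteq> V" for xs
    using that assms by (induction xs) auto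
  then show ?thesis unfolding n_fold_products_def by blast
qed

lemma products_mult:
  assumes "V \<subseteq> carrier B" "x \<in> n_fold_products B V m" "y \<in> n_fold_products B V n"
  shows "x \<otimes>\<^bsub>B\<^esub> y \<in> n_fold_products B V (m + n)"
proof -
  obtain xs ys where xs: "x = foldr (mult B) xs \<one>\<^bsub>B\<^esub>" "set xs \<subseteq> V" "length xs = m"
    and ys: "y = foldr (mult B) ys \<one>\<^bsub>B\<^esub>" "set ys \<subseteq> V" "length ys = n"
    using assms unfolding n_fold_products_def by blast
  have closed: "foldr (mult B) zs \<one>\<^bsub>B\<^esub> \<in> carrier B" if "set zs \<subseteq> V" for zs
    using that assms(1) by (induction zs) auto
  have "foldr (mult B) xs \<one>\<^bsub>B\<^esub> \<otimes>\<^bsub>B\<^esub> y = foldr (mult B) (xs @ ys) \<one>\<^bsub>B\<^esub>"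
    using xs(2)
  proof (induction xs)
    case Nil
    then show ?case using closed[OF ys(2)] by (simp add: ys(1))
  next
    case (Cons a xs)
    have "a \<in> carrier B" "set xs \<subseteq> V" using Cons.prems assms(1) by auto
    then show ?case
      using Cons.IH closed[of xs] closed[OF ys(2)] by (simp add: B.m_assoc ys(1))
  qed
  moreover have "set (xs @ ys) \<subseteq> V" "length (xs @ ys) = m + n" using xs ys by auto
  ultimately show ?thesis unfolding n_fold_products_def xs(1) by blast
qed

lemma products_subset_growth:
  assumes "V \<subseteq> carrier B" "k \<le> n"
  shows "n_fold_products B V k \<subseteq> growth_space R B V n"
proof -
  have "(\<Union>k\<le>n. n_fold_products B V k) \<subseteq> carrier B" using products_closed[OF assms(1)] by blast
  then show ?thesis unfolding growth_space_def using B.in_own_span assms(2) by blast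
qed

lemma growth_submodule:
  assumes "V \<subseteq> carrier B"
  shows "LinearCombinations.submodule R (growth_space R B V n) B"
  unfolding growth_space_def using products_closed[OF assms] by (intro B.span_is_submodule) blast

lemma growth_subspace:
  assumes "V \<subseteq> carrier B"
  shows "VectorSpace.subspace R (growth_space R B V n) B"
  using growth_submodule[OF assms] by (simp add: VectorSpace.subspace_def B.vectorspace_axioms)

lemma growth_minimal:
  assumes "LinearCombinations.submodule R H B" "\<And>k. k \<le> n \<Longrightarrow> n_fold_products B V k \<subseteq> H"
  shows "growth_space R B V n \<subseteq> H"
  unfolding growth_space_def by (rule B.span_is_subset[OF _ assms(1)]) (use assms(2) in blast)

lemma growth_closed:
  assumes "V \<subseteq> carrier B"
  shows "growth_space R B V n \<subseteq> carrier B"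
  using growth_submodule[OF assms] by (rule LinearCombinations.submodule.subset)

text \<open>Bilinear extension in two stages: for a fixed product \<open>y\<close> the admissible
  left factors form a submodule, and then so do the admissible right factors for fixed
  \<open>x\<close>.\<close>

lemma growth_mult:
  assumes V: "V \<subseteq> carrier B" and x: "x \<in> growth_space R B V m" and y: "y \<in> growth_space R B V n"
  shows "x \<otimes>\<^bsub>B\<^esub> y \<in> growth_space R B V (m + n)"
proof -
  note G = growth_submodule[OF V, of "m + n"]
  note G_zero = LinearCombinations.submodule.zero_closed[OF G]
    and G_add = LinearCombinations.submodule.m_closed[OF G]
    and G_smult = LinearCombinations.submodule.smult_closed[OF G]
  have left: "x \<otimes>\<^bsub>B\<^esub> y \<in> growth_space R B V (m + n)"
    if "x \<in> growth_space R B V m" "y \<in> n_fold_products B V k" "k \<le> n" for x y k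
  proof -
    have y: "y \<in> carrier B" using that(2) products_closed[OF V] by blast
    let ?H = "{x \<in> carrier B. x \<otimes>\<^bsub>B\<^esub> y \<in> growth_space R B V (m + n)}"
    have "LinearCombinations.submodule R ?H B"
      using y G_zero G_add G_smult by (intro submoduleI) (auto simp: B.l_distr B_smult_mult)
    moreover have "n_fold_products B V j \<subseteq> ?H" if "j \<le> m" for j
      using products_mult[OF V _ \<open>y \<in> n_fold_products B V k\<close>, of _ j] products_closed[OF V, of j]
        products_subset_growth[OF V, of "j + k" "m + n"] \<open>k \<le> n\<close> that by fastforce
    ultimately have "growth_space R B V m \<subseteq> ?H" by (rule growth_minimal)
    then show ?thesis using that(1) by blast
  qed
  have xc: "x \<in> carrier B" using x growth_closed[OF V] by blast
  let ?H = "{y \<in> carrier B. x \<otimes>\<^bsub>B\<^esub> y \<in> growth_space R B V (m + n)}"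
  have "LinearCombinations.submodule R ?H B"
    using xc G_zero G_add G_smult by (intro submoduleI) (auto simp: B.r_distr B_smult_mult)
  moreover have "n_fold_products B V k \<subseteq> ?H" if "k \<le> n" for k
    using left[OF x _ that] products_closed[OF V, of k] by blast
  ultimately have "growth_space R B V n \<subseteq> ?H" by (rule growth_minimal)
  then show ?thesis using y by blast
qed

lemma growth_space_le_short:
  assumes "V \<subseteq> short c"
  shows "growth_space R B V n \<subseteq> short (c * n)"
proof (rule growth_minimal[OF short_submodule])
  fix k assume k: "k \<le> n"
  have "foldr (mult B) xs \<one>\<^bsub>B\<^esub> \<in> short (c * length xs)" if "set xs \<subseteq> V" for xs
    using that
  proof (induction xs)
    case Nil
    show ?case unfolding foldr.simps id_apply B_one
      by (rule shortI) (auto simp: monomial_closed_free, simp add: monomial_def split: if_splits)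
  next
    case (Cons x xs)
    then have "x \<otimes>\<^bsub>B\<^esub> foldr (mult B) xs \<one>\<^bsub>B\<^esub> \<in> short (c + c * length xs)"
      using assms by (intro short_mult) auto
    then show ?case by simp
  qed
  then show "n_fold_products B V k \<subseteq> short (c * n)"
    using k short_mono[of "c * k" "c * n"] unfolding n_fold_products_def by fastforce
qed

text \<open>A word is a product of its letters, so by \<open>growth_mult\<close> each letter adds
  \<open>e\<close> to the index.\<close>

lemma short_le_growth_space:
  assumes V: "V \<subseteq> carrier B" and letter: "\<And>a. a < d \<Longrightarrow> word [a] \<in> growth_space R B V e"
  shows "short n \<subseteq> growth_space R B V (e * n)"
proof -
  have one: "\<one>\<^bsub>B\<^esub> \<in> growth_space R B V 0"
    using products_subset_growth[OF V, of 0 0] by (auto simp: n_fold_products_def)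
  have word: "word w \<in> growth_space R B V (e * length w)" if "w \<in> lists {..<d}" for w
    using that
  proof (induction w)
    case Nil
    then show ?case using one by (simp add: B_one)
  next
    case (Cons a w)
    then have "word [a] \<otimes>\<^bsub>B\<^esub> word w \<in> growth_space R B V (e + e * length w)"
      by (intro growth_mult V letter) auto
    then show ?case using word_Cons[of a w] Cons.hyps by simp
  qed
  have "word ` short_words n \<subseteq> growth_space R B V (e * n)"
  proof clarify
    fix w assume w: "w \<in> L" "length w \<le> n"
    then have "growth_space R B V (e * length w) \<subseteq> growth_space R B V (e * n)"
      by (intro growth_space_mono B_module) simp
    then show "word w \<in> growth_space R B V (e * n)" using word w(1) L_alphabet by blast
  qed
  then have "B.span (word ` short_words n) \<subseteq> growth_space R B V (e * n)"
    using growth_submodule[OF V] by (rule B.span_is_subset)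
  then show ?thesis unfolding span_word .
qed

text \<open>A finite spanning set of \<open>V\<close> has bounded degree; the \<open>Suc\<close>
  makes the constant positive.\<close>

lemma generating_short:
  assumes "fd_generating_subspace R B V"
  shows "\<exists>c\<ge>1. V \<subseteq> short c"
proof -
  have sub: "VectorSpace.subspace R V B" and fd: "vectorspace.fin_dim R (B\<lparr>carrier := V\<rparr>)"
    using assms unfolding fd_generating_subspace_def by blast+
  interpret V: vectorspace R "B\<lparr>carrier := V\<rparr>" using sub by (rule B.subspace_is_vs)
  have submod: "LinearCombinations.submodule R V B" using sub by (rule B.is_module)
  then have VB: "V \<subseteq> carrier B" by (rule LinearCombinations.submodule.subset)
  obtain T where T: "finite T" "T \<subseteq> V" "V.span T = V" using fd unfolding V.fin_dim_def by auto
  have "\<forall>t \<in> T. \<exists>n. t \<in> short n" using T(2) VB carrier_short by blast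
  then obtain m where m: "\<And>t. t \<in> T \<Longrightarrow> t \<in> short (m t)" by metis
  obtain c where c: "\<forall>k \<in> m ` T. k \<le> c" using T(1) finite_nat_set_iff_bounded_le[of "m ` T"] by auto
  have "T \<subseteq> short (Suc c)"
  proof
    fix t assume "t \<in> T"
    then show "t \<in> short (Suc c)" using m c short_mono[of "m t" "Suc c"] by force
  qed
  then have "B.span T \<subseteq> short (Suc c)" using short_submodule by (rule B.span_is_subset)
  moreover have "B.span T = V" using B.span_li_not_depend(1)[OF T(2) submod] T(3) by simp
  ultimately show ?thesis by (intro exI[of _ "Suc c"]) simp
qed

text \<open>The union of the growth spaces is a subalgebra containing \<open>V\<close>, hence
  everything; finitely many letters then fit into one growth space.\<close>

lemma generating_letters:
  assumes "fd_generating_subspace R B V"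
  shows "\<exists>e\<ge>1. \<forall>a<d. word [a] \<in> growth_space R B V e"
proof -
  have sub: "VectorSpace.subspace R V B"
    and gen: "\<And>A. subring A B \<Longrightarrow> VectorSpace.subspace R A B \<Longrightarrow> V \<subseteq> A \<Longrightarrow> A = carrier B"
    using assms unfolding fd_generating_subspace_def by blast+
  have V: "V \<subseteq> carrier B"
    using sub B.is_module LinearCombinations.submodule.subset by blast
  let ?A = "\<Union>n. growth_space R B V n"
  have up: "growth_space R B V m \<subseteq> growth_space R B V n" if "m \<le> n" for m n
    using growth_space_mono[OF B_module that] .
  have A_sub: "?A \<subseteq> carrier B" using growth_closed[OF V] by blast
  have A_add: "x \<oplus>\<^bsub>B\<^esub> y \<in> ?A" if xy: "x \<in> ?A" "y \<in> ?A" for x y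
  proof -
    obtain m n where "x \<in> growth_space R B V m" "y \<in> growth_space R B V n" using xy by blast
    then have "x \<in> growth_space R B V (max m n)" "y \<in> growth_space R B V (max m n)"
      using up[of m "max m n"] up[of n "max m n"] by auto
    then show ?thesis using LinearCombinations.submodule.m_closed[OF growth_submodule[OF V]] by blast
  qed
  have A_smult: "c \<odot>\<^bsub>B\<^esub> x \<in> ?A" if "c \<in> carrier R" "x \<in> ?A" for c x
    using that LinearCombinations.submodule.smult_closed[OF growth_submodule[OF V]] by blast
  have A_mod: "LinearCombinations.submodule R ?A B"
  proof (rule submoduleI[OF A_sub _ A_add A_smult])
    show "\<zero>\<^bsub>B\<^esub> \<in> ?A"
      using LinearCombinations.submodule.zero_closed[OF growth_submodule[OF V, of 0]] by (rule UN_I[OF UNIV_I])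
  qed
  have "subring ?A B"
  proof (rule B.subringI)
    show "?A \<subseteq> carrier B" by (rule A_sub)
    show "\<one>\<^bsub>B\<^esub> \<in> ?A"
      using products_subset_growth[OF V, of 0 0] by (auto simp: n_fold_products_def)
    show "\<ominus>\<^bsub>B\<^esub> x \<in> ?A" if "x \<in> ?A" for x
    proof -
      have "\<ominus>\<^bsub>B\<^esub> x = (\<ominus> \<one>) \<odot>\<^bsub>B\<^esub> x"
        using that A_sub B.smult_l_minus[of \<one> x] by auto
      then show ?thesis using A_smult[of "\<ominus> \<one>" x] that by simp
    qed
    show "x \<otimes>\<^bsub>B\<^esub> y \<in> ?A" if "x \<in> ?A" "y \<in> ?A" for x y
      using that growth_mult[OF V] by blast
  qed (rule A_add)
  moreover have "VectorSpace.subspace R ?A B"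
    using A_mod by (simp add: VectorSpace.subspace_def B.vectorspace_axioms)
  moreover have "V \<subseteq> ?A"
  proof
    fix v assume v: "v \<in> V"
    then have "v = foldr (mult B) [v] \<one>\<^bsub>B\<^esub>" using V by auto
    then have "v \<in> n_fold_products B V 1"
      using v unfolding n_fold_products_def by (intro CollectI exI[of _ "[v]"]) simp
    then show "v \<in> ?A" using products_subset_growth[OF V, of 1 1] by blast
  qed
  ultimately have A: "?A = carrier B" by (rule gen)
  have "\<forall>a. \<exists>n. a < d \<longrightarrow> word [a] \<in> growth_space R B V n"
  proof
    fix a
    have "a < d \<Longrightarrow> word [a] \<in> carrier B" by (intro cl_closed monomial_closed_free) simp
    then show "\<exists>n. a < d \<longrightarrow> word [a] \<in> growth_space R B V n" using A by blast
  qed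
  then obtain m where m: "\<And>a. a < d \<Longrightarrow> word [a] \<in> growth_space R B V (m a)" by metis
  obtain e where "\<forall>k \<in> m ` {..<d}. k \<le> e" using finite_nat_set_iff_bounded_le[of "m ` {..<d}"] by auto
  then have "word [a] \<in> growth_space R B V (Suc e)" if "a < d" for a
    using m[OF that] up[of "m a" "Suc e"] that by force
  then show ?thesis by (intro exI[of _ "Suc e"]) simp
qed

text \<open>A subalgebra containing the letters contains all words, and these span
  \<open>B\<close>.\<close>

lemma short_generating: "fd_generating_subspace R B (short 1)"
  unfolding fd_generating_subspace_def
proof (intro conjI allI impI)
  show "VectorSpace.subspace R (short 1) B" by (rule short_subspace)
  show "vectorspace.fin_dim R (B\<lparr>carrier := short 1\<rparr>)" by (rule dim_short)
  fix A assume A: "subring A B \<and> VectorSpace.subspace R A B \<and> short 1 \<subseteq> A"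
  then have ring: "subring A B" and sub: "VectorSpace.subspace R A B" and short: "short 1 \<subseteq> A" by blast+
  have submod: "LinearCombinations.submodule R A B" using sub by (rule B.is_module)
  have word: "word w \<in> A" if "w \<in> lists {..<d}" for w
    using that
  proof (induction w)
    case Nil
    then show ?case using subringE(3)[OF ring] by (simp add: B_one)
  next
    case (Cons a w)
    have "word [a] \<in> short 1"
      using Cons.hyps by (intro shortI monomial_closed_free) (auto simp: monomial_def split: if_splits)
    then have "word [a] \<otimes>\<^bsub>B\<^esub> word w \<in> A" using Cons short subringE(6)[OF ring] by auto
    then show ?case using word_Cons[of a w] Cons.hyps by simp
  qed
  have words: "word ` short_words n \<subseteq> A" for n using word L_alphabet by blast
  have "short n \<subseteq> A" for n
    using B.span_is_subset[OF words submod] unfolding span_word .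
  then have "carrier B \<subseteq> A" using carrier_short by blast
  then show "A = carrier B" using LinearCombinations.submodule.subset[OF submod] by blast
qed

lemma growth_bounds:
  assumes "fd_generating_subspace R B V"
  shows "\<exists>c\<ge>1. \<exists>e\<ge>1. \<forall>n. growth_function R B V n \<le> card (short_words (c * n)) \<and>
    card (short_words n) \<le> growth_function R B V (e * n)"
proof -
  have sub: "VectorSpace.subspace R V B" using assms unfolding fd_generating_subspace_def by blast
  have V: "V \<subseteq> carrier B"
    using sub B.is_module LinearCombinations.submodule.subset by blast
  obtain c where c: "c \<ge> 1" "V \<subseteq> short c" using generating_short[OF assms] by blast
  obtain e where e: "e \<ge> 1" "\<forall>a<d. word [a] \<in> growth_space R B V e"
    using generating_letters[OF assms] by blast
  \<comment> \<open>This comparison also shows that the growth spaces are finite-dimensional, which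
    the reverse comparison requires.\<close>
  have upper: "vectorspace.fin_dim R (B\<lparr>carrier := growth_space R B V n\<rparr>)"
    "growth_function R B V n \<le> card (short_words (c * n))" for n
    using B.subspace_fin_dim_mono[OF growth_subspace[OF V] short_subspace
        growth_space_le_short[OF c(2)] dim_short(1)] dim_short(2)
    unfolding growth_function_def by simp_all
  have "card (short_words n) \<le> growth_function R B V (e * n)" for n
    using B.subspace_fin_dim_mono(2)[OF short_subspace growth_subspace[OF V]
        short_le_growth_space[OF V] upper(1)] e(2) dim_short(2)
    unfolding growth_function_def by simp
  then show ?thesis using c(1) e(1) upper(2) by blast
qed

lemma growth_type:
  assumes lower: "\<And>n. n \<ge> 1 \<Longrightarrow> f n \<le> card (short_words (A * n))" "A \<ge> 1"
    and upper: "\<And>n. n \<ge> 1 \<Longrightarrow> card (short_words n) \<le> f (D * n)" "D \<ge> 1"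
  shows "has_growth_type R B f"
  unfolding has_growth_type_def
proof (intro conjI allI impI)
  show "\<exists>V. fd_generating_subspace R B V" using short_generating by blast
  fix V assume "fd_generating_subspace R B V"
  then obtain c e where bounds: "c \<ge> 1" "e \<ge> 1"
    "\<forall>n. growth_function R B V n \<le> card (short_words (c * n)) \<and>
      card (short_words n) \<le> growth_function R B V (e * n)"
    using growth_bounds[of V] by blast
  note ce = bounds(1,2) bounds(3)[rule_format, THEN conjunct1] bounds(3)[rule_format, THEN conjunct2]
  show "growth_equiv (growth_function R B V) f"
    unfolding growth_equiv_def
  \<comment> \<open>The two constants are fixed by the chains of inequalities below:
    \<open>D * c\<close> and \<open>e * A * D * c\<close>.\<close>
  proof (intro exI conjI allI impI)
    fix n :: nat assume n: "n \<ge> 1"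
    have "growth_function R B V n \<le> card (short_words (c * n))" by (rule ce)
    also have "\<dots> \<le> f (D * (c * n))" using ce n by (intro upper) simp
    finally show "growth_function R B V n \<le> f ((D * c) * n)" by (simp only: mult.assoc)
    have "f ((D * c) * n) \<le> card (short_words (A * (D * c * n)))" using ce n upper(2) by (intro lower) simp
    also have "\<dots> \<le> growth_function R B V (e * (A * (D * c * n)))" by (rule ce)
    finally show "f ((D * c) * n) \<le> growth_function R B V ((e * A * D * c) * n)" by (simp only: mult.assoc)
  qed (use ce upper(2) lower(2) in simp_all)
qed

end

theorem theorem1p4:
  fixes F :: "('a, 'b) ring_scheme" and f :: "nat \<Rightarrow> nat"
  assumes "field F"
    and "\<forall>n\<ge>1. f n \<ge> 1"
    and "\<forall>n\<ge>1. f n \<le> f (n + 1)"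
    and "\<forall>m\<ge>1. \<forall>n\<ge>1. f (m + n) \<le> f m * f n"
    and "\<exists>C\<ge>1. \<forall>n\<ge>1. f (C * n) \<ge> n * f n"
  shows "\<exists>B. fg_monomial_algebra F B \<and> prime_ring B \<and>
    (\<exists>J. ideal J B \<and> J \<noteq> {\<zero>\<^bsub>B\<^esub>} \<and> locally_nilpotent B J) \<and>
    has_growth_type F B f"
proof -
  interpret f: submultiplicative f
    using assms(2-4) by unfold_locales auto
  interpret M: monomial_quotient F "Suc (2 * f 1)" f.lang
  proof -
    have "f.lang \<noteq> {}" using f.W_nonempty f.W_subset_lang by blast
    then show "monomial_quotient F (Suc (2 * f 1)) f.lang"
      using assms(1) f.lang_alphabet f.lang_sublist
      by (simp add: monomial_quotient_def monomial_quotient_axioms_def)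
  qed
  have "[0] \<in> f.lang" using f.W_subset_lang[of 0] by auto
  obtain C where C: "C \<ge> 1" "\<And>n. n \<ge> 1 \<Longrightarrow> f (C * n) \<ge> n * f n" using assms(5) by blast
  obtain D where D: "D \<ge> 1" "\<forall>n\<ge>1. card {s \<in> f.lang. length s \<le> n} \<le> f (D * n)"
    using f.growth_upper_linear[OF C] by blast
  show ?thesis
  proof (intro exI conjI)
    show "fg_monomial_algebra F M.B" by (rule M.fg_monomial)
    show "prime_ring M.B"
      using f.lang_prime[OF f.suffix_target] by (rule M.prime_B)
    show "ideal M.marked_ideal M.B" by (rule M.marked_ideal_ideal)
    show "M.marked_ideal \<noteq> {\<zero>\<^bsub>M.B\<^esub>}"
      using \<open>[0] \<in> f.lang\<close> by (rule M.marked_ideal_nonzero)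
    show "locally_nilpotent M.B M.marked_ideal"
      using f.lang_zeros_sparse[OF f.zero_free_heads] by (rule M.marked_ideal_locally_nilpotent)
    show "has_growth_type F M.B f"
      using f.growth_lower D by (intro M.growth_type[of f 2 D]) auto
  qed
qed

end
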